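(* Let $\Pi=\{\mathcal H,\Gamma_0,\Gamma_1\}$ be a unitary boundary triple for $A^*$ with Weyl function $M(\cdot)$ and $\gamma$-field $\gamma(\cdot)$. Then the following statements are equivalent: (i) $\Pi$ is an ES-generalized boundary triple for $A^*$, i.e. $A_0=\ker\Gamma_0$ is essentially selfadjoint; (ii) $\gamma(i)$ and $\gamma(-i)$ are closable; (iii) $\gamma(\lambda)$ is closable for every $\lambda\in\mathbb C_+\cup\mathbb C_-$, and $\operatorname{dom}\overline{\gamma(\lambda)}=\operatorname{dom}\overline{\gamma(\pm i)}$ for all $\lambda\in\mathbb C_\pm$; (iv) the forms $\mathfrak t_{M(i)}$ and $\mathfrak t_{M(-i)}$ are closable; (v) the form $\mathfrak t_{M(\lambda)}$ is closable for every $\lambda\in\mathbb C_\pm$ and $\operatorname{dom}\overline{\mathfrak t_{M(\lambda)}}=\operatorname{dom}\overline{\mathfrak t_{M(\pm i)}}$ for $\lambda\in\mathbb C_\pm$; (vi) $M(\cdot)\in\mathcal R^s(\mathcal H)$ and $M$ is form domain invariant in $\mathbb C_+$ and in $\mathbb C_-$. Moreover, if these conditions hold, then $\operatorname{dom}\overline{\mathfrak t_{M(\lambda)}}=\operatorname{dom}\overline{\gamma(\lambda)}=\operatorname{ran}\overline{\Gamma_0}$ for all $\lambda\in\mathbb C\setminus\mathbb R$, where $\overline{\Gamma_0}$ is the closure of $\Gamma_0$ as a linear relation from $\mathfrak H^2$ to $\mathcal H$.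
   Context: All Hilbert spaces are separable. A linear relation from $\mathfrak X$ to $\mathfrak Y$ is a linear subspace of $\mathfrak X\times\mathfrak Y$; operators are identified with their graphs; $\operatorname{dom},\operatorname{ran},\ker$, $\operatorname{mul}T=\{g:\{0,g\}\in T\}$, closure, inverse and adjoint are defined as usual for relations. A relation $T$ in $\mathfrak H$ is symmetric if $T\subset T^*$, selfadjoint if $T=T^*$, essentially selfadjoint if $\overline T=T^*$. $A$ is a closed symmetric linear relation in a Hilbert space $\mathfrak H$; $\mathcal H$ is another Hilbert space. Elements of $\mathfrak H^2$ are written $\hat f=\{f,f'\}$. A linear operator $\Gamma=\{\Gamma_0,\Gamma_1\}$ from $\mathfrak H^2$ to $\mathcal H^2$ is isometric if the Green identity $(f',g)_{\mathfrak H}-(f,g')_{\mathfrak H}=(\Gamma_1\hat f,\Gamma_0\hat g)_{\mathcal H}-(\Gamma_0\hat f,\Gamma_1\hat g)_{\mathcal H}$ holds for all $\hat f,\hat g\in\operatorname{dom}\Gamma$, and unitary if moreover $\Gamma^{-1}=\Gamma^{[*]}$, where $\Gamma^{[*]}=\{\{\hat k,\hat g\}\in\mathcal H^2\times\mathfrak H^2:\ (f',g)-(f,g')=(h',k)-(h,k')\text{ for all }\{\hat f,\{h,h'\}\}\in\Gamma\}$ with $\hat k=\{k,k'\}$ (i.e. $\Gamma$ is unitary between the Kreĭn spaces $(\mathfrak H^2,J_{\mathfrak H})$, $(\mathcal H^2,J_{\mathcal H})$, $J=\begin{pmatrix}0&-iI\\ iI&0\end{pmatrix}$). $\{\mathcal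 H,\Gamma_0,\Gamma_1\}$ is a unitary (isometric) boundary triple for $A^*$ if $\Gamma$ is unitary (isometric) and $A_*:=\operatorname{dom}\Gamma\subset A^*$ is dense in $A^*$. $A_0:=\ker\Gamma_0$. Weyl function and $\gamma$-field: for $\lambda\in\mathbb C\setminus\mathbb R$ and $\hat f_\lambda=\{f_\lambda,\lambda f_\lambda\}\in A_*$, $M(\lambda)\Gamma_0\hat f_\lambda=\Gamma_1\hat f_\lambda$ and $\gamma(\lambda)\Gamma_0\hat f_\lambda=f_\lambda$ (so $\operatorname{dom}M(\lambda)=\operatorname{dom}\gamma(\lambda)=\Gamma_0(\{\{f,\lambda f\}\in A_*\})$). For an operator-valued $M$, $\mathfrak t_{M(\lambda)}[u,v]=\frac{1}{\lambda-\bar\lambda}[(M(\lambda)u,v)-(u,M(\lambda)v)]$, $u,v\in\operatorname{dom}M(\lambda)$. $M$ is form domain invariant in $\mathbb C_+$ ($\mathbb C_-$) if $\mathfrak t_{M(\lambda)}$ is closable for all $\lambda$ in that half-plane and the closures have a common domain. $\mathcal R(\mathcal H)$ is the class of functions on $\mathbb C\setminus\mathbb R$ whose values are closed operators in $\mathcal H$, maximal dissipative for $\lambda\in\mathbb C_+$, with $M(\lambda)^*=M(\bar\lambda)$ and $\lambda\mapsto(M(\lambda)+\mu)^{-1}$ holomorphic on $\mathbb C_+$ (some/all $\mu\in\mathbb C_+$); $\mathcal R^s(\mathcal H)$ consists of those $F\in\mathcal R(\mathcal H)$ with: $h\in\operatorname{dom}F(i)$, $\operatorname{Im}(F(i)h,h)=0\Rightarrow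 h=0$. *)

theory Defs
  imports "HOL-Analysis.Analysis"
begin

class complex_inner = ab_group_add +
  fixes scaleC :: "complex \<Rightarrow> 'a \<Rightarrow> 'a" (infixr "*\<^sub>C" 75)
    and cinner :: "'a \<Rightarrow> 'a \<Rightarrow> complex"
  assumes scaleC_add_right: "a *\<^sub>C (x + y) = a *\<^sub>C x + a *\<^sub>C y"
    and scaleC_add_left: "(a + b) *\<^sub>C x = a *\<^sub>C x + b *\<^sub>C x"
    and scaleC_scaleC: "a *\<^sub>C (b *\<^sub>C x) = (a * b) *\<^sub>C x"
    and scaleC_one: "1 *\<^sub>C x = x"
    and cinner_add_left: "cinner (x + y) z = cinner x z + cinner y z"
    and cinner_scaleC_left: "cinner (a *\<^sub>C x) y = a * cinner x y"
    and cinner_commute: "cinner y x = cnj (cinner x y)"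
    and cinner_self_real: "Im (cinner x x) = 0"
    and cinner_self_nonneg: "Re (cinner x x) \<ge> 0"
    and cinner_self_eq_zero: "cinner x x = 0 \<longleftrightarrow> x = 0"

definition cnorm :: "'a::complex_inner \<Rightarrow> real" where
  "cnorm x = sqrt (Re (cinner x x))"

definition cconv :: "(nat \<Rightarrow> 'a::complex_inner) \<Rightarrow> 'a \<Rightarrow> bool" where
  "cconv X x \<longleftrightarrow> (\<lambda>n. cnorm (X n - x)) \<longlonglongrightarrow> 0"

definition ccauchy :: "(nat \<Rightarrow> 'a::complex_inner) \<Rightarrow> bool" where
  "ccauchy X \<longleftrightarrow> (\<forall>e>0. \<exists>N. \<forall>m\<ge>N. \<forall>n\<ge>N. cnorm (X m - X n) < e)"

class complex_hilbert = complex_inner +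
  assumes complete_cinner:
    "\<forall>e>0. \<exists>N. \<forall>m\<ge>N. \<forall>n\<ge>N. sqrt (Re (cinner (X m - X n) (X m - X n))) < e
      \<Longrightarrow> \<exists>L. (\<lambda>n. sqrt (Re (cinner (X n - L) (X n - L)))) \<longlonglongrightarrow> 0"
    and separable_cinner:
    "\<exists>D. countable D \<and> (\<forall>x. \<forall>e>0. \<exists>d\<in>D. sqrt (Re (cinner (x - d) (x - d))) < e)"

instantiation prod :: (complex_inner, complex_inner) complex_inner
begin
definition scaleC_prod_def: "a *\<^sub>C x = (a *\<^sub>C fst x, a *\<^sub>C snd x)"
definition cinner_prod_def: "cinner x y = cinner (fst x) (fst y) + cinner (snd x) (snd y)"
instance
proof
  fix a b :: complex and x y z :: "'a \<times> 'b"
  show "a *\<^sub>C (x + y) = a *\<^sub>C x + a *\<^sub>C y"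
    by (simp add: scaleC_prod_def scaleC_add_right)
  show "(a + b) *\<^sub>C x = a *\<^sub>C x + b *\<^sub>C x"
    by (simp add: scaleC_prod_def scaleC_add_left)
  show "a *\<^sub>C (b *\<^sub>C x) = (a * b) *\<^sub>C x"
    by (simp add: scaleC_prod_def scaleC_scaleC)
  show "1 *\<^sub>C x = x"
    by (simp add: scaleC_prod_def scaleC_one)
  show "cinner (x + y) z = cinner x z + cinner y z"
    by (simp add: cinner_prod_def cinner_add_left)
  show "cinner (a *\<^sub>C x) y = a * cinner x y"
    by (simp add: cinner_prod_def scaleC_prod_def cinner_scaleC_left algebra_simps)
  show "cinner y x = cnj (cinner x y)"
    by (simp add: cinner_prod_def cinner_commute[of "fst x"] cinner_commute[of "snd x"])
  show "Im (cinner x x) = 0"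
    by (simp add: cinner_prod_def cinner_self_real)
  show "Re (cinner x x) \<ge> 0"
    by (simp add: cinner_prod_def cinner_self_nonneg add_nonneg_nonneg)
  show "cinner x x = 0 \<longleftrightarrow> x = 0"
  proof
    assume h: "cinner x x = 0"
    have r1: "Re (cinner (fst x) (fst x)) \<ge> 0" "Re (cinner (snd x) (snd x)) \<ge> 0"
      by (simp_all add: cinner_self_nonneg)
    from arg_cong[where f=Re, OF h] have "Re (cinner (fst x) (fst x)) + Re (cinner (snd x) (snd x)) = 0"
      by (simp add: cinner_prod_def)
    with r1 have "Re (cinner (fst x) (fst x)) = 0" "Re (cinner (snd x) (snd x)) = 0" by linarith+
    then have "cinner (fst x) (fst x) = 0" "cinner (snd x) (snd x) = 0"
      using cinner_self_real complex_eqI by (metis zero_complex.simps)+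
    then show "x = 0" by (simp add: cinner_self_eq_zero prod_eq_iff)
  next
    assume "x = 0" then show "cinner x x = 0"
      using cinner_self_eq_zero[of "0::'a"] cinner_self_eq_zero[of "0::'b"]
      by (simp add: cinner_prod_def)
  qed
qed
end

text \<open>A linear relation from 'a to 'b is a linear subspace of 'a \<times> 'b.\<close>

definition csubspace :: "'a::complex_inner set \<Rightarrow> bool" where
  "csubspace S \<longleftrightarrow> 0 \<in> S \<and> (\<forall>x\<in>S. \<forall>y\<in>S. x + y \<in> S) \<and> (\<forall>a. \<forall>x\<in>S. a *\<^sub>C x \<in> S)"

text \<open>Norm closure (sequential closure, which is the closure in a normed space).\<close>

definition hclosure :: "'a::complex_inner set \<Rightarrow> 'a set" where
  "hclosure S = {x. \<exists>X. (\<forall>n. X n \<in> S) \<and> cconv X x}"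

definition hclosed :: "'a::complex_inner set \<Rightarrow> bool" where
  "hclosed S \<longleftrightarrow> hclosure S = S"

definition radjoint :: "('a::complex_inner \<times> 'b::complex_inner) set \<Rightarrow> ('b \<times> 'a) set" where
  "radjoint T = {(k, k'). \<forall>(f, f') \<in> T. cinner f' k = cinner f k'}"

definition rmul :: "('a::zero \<times> 'b) set \<Rightarrow> 'b set" where
  "rmul T = {g. (0, g) \<in> T}"

definition is_operator :: "('a \<times> 'b) set \<Rightarrow> bool" where
  "is_operator T \<longleftrightarrow> (\<forall>f g g'. (f, g) \<in> T \<and> (f, g') \<in> T \<longrightarrow> g = g')"

text \<open>A (linear) operator is closable iff the closure of its graph is again an operator,
  i.e. the multivalued part of the closure is trivial.\<close>

definition rclosable :: "('a::complex_inner \<times> 'b::complex_inner) set \<Rightarrow> bool" where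
  "rclosable T \<longleftrightarrow> rmul (hclosure T) = {0}"

definition symmetric_rel :: "('a::complex_inner \<times> 'a) set \<Rightarrow> bool" where
  "symmetric_rel T \<longleftrightarrow> T \<subseteq> radjoint T"

definition ess_selfadjoint :: "('a::complex_inner \<times> 'a) set \<Rightarrow> bool" where
  "ess_selfadjoint T \<longleftrightarrow> hclosure T = radjoint T"

definition dissipative :: "('a::complex_inner \<times> 'a) set \<Rightarrow> bool" where
  "dissipative T \<longleftrightarrow> (\<forall>(f, f') \<in> T. Im (cinner f' f) \<ge> 0)"

definition max_dissipative :: "('a::complex_inner \<times> 'a) set \<Rightarrow> bool" where
  "max_dissipative T \<longleftrightarrow> csubspace T \<and> dissipative T \<and>
     (\<forall>S. csubspace S \<and> dissipative S \<and> T \<subseteq> S \<longrightarrow> S = T)"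

text \<open>The operator \<Gamma> = {\<Gamma>0, \<Gamma>1} with domain Dom (a subspace of \<HH>^2), given by
  the pair of maps G0, G1 on Dom; its graph as a relation from \<HH>^2 to \<H>^2.\<close>

definition Gamma_graph ::
  "('h \<times> 'h) set \<Rightarrow> ('h \<times> 'h \<Rightarrow> 'k) \<Rightarrow> ('h \<times> 'h \<Rightarrow> 'k) \<Rightarrow> (('h \<times> 'h) \<times> ('k \<times> 'k)) set" where
  "Gamma_graph Dom G0 G1 = {(fh, (G0 fh, G1 fh)) | fh. fh \<in> Dom}"

definition Gamma0_graph :: "('h \<times> 'h) set \<Rightarrow> ('h \<times> 'h \<Rightarrow> 'k) \<Rightarrow> (('h \<times> 'h) \<times> 'k) set" where
  "Gamma0_graph Dom G0 = {(fh, G0 fh) | fh. fh \<in> Dom}"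

definition linear_on :: "'a::complex_inner set \<Rightarrow> ('a \<Rightarrow> 'b::complex_inner) \<Rightarrow> bool" where
  "linear_on D G \<longleftrightarrow> csubspace D \<and> (\<forall>x\<in>D. \<forall>y\<in>D. G (x + y) = G x + G y) \<and>
     (\<forall>a. \<forall>x\<in>D. G (a *\<^sub>C x) = a *\<^sub>C G x)"

definition krein_adjoint ::
  "(('a::complex_inner \<times> 'a) \<times> ('b::complex_inner \<times> 'b)) set \<Rightarrow> (('b \<times> 'b) \<times> ('a \<times> 'a)) set" where
  "krein_adjoint \<Gamma> = {(kh, gh). \<forall>(fh, hh) \<in> \<Gamma>.
      cinner (snd fh) (fst gh) - cinner (fst fh) (snd gh)
      = cinner (snd hh) (fst kh) - cinner (fst hh) (snd kh)}"

definition isometric_bt ::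
  "('h::complex_inner \<times> 'h) set \<Rightarrow> ('h \<times> 'h \<Rightarrow> 'k::complex_inner) \<Rightarrow> ('h \<times> 'h \<Rightarrow> 'k) \<Rightarrow> bool" where
  "isometric_bt Dom G0 G1 \<longleftrightarrow> linear_on Dom G0 \<and> linear_on Dom G1 \<and>
     (\<forall>fh\<in>Dom. \<forall>gh\<in>Dom.
        cinner (snd fh) (fst gh) - cinner (fst fh) (snd gh)
        = cinner (G1 fh) (G0 gh) - cinner (G0 fh) (G1 gh))"

definition unitary_bt ::
  "('h::complex_inner \<times> 'h) set \<Rightarrow> ('h \<times> 'h \<Rightarrow> 'k::complex_inner) \<Rightarrow> ('h \<times> 'h \<Rightarrow> 'k) \<Rightarrow> bool" where
  "unitary_bt Dom G0 G1 \<longleftrightarrow> isometric_bt Dom G0 G1 \<and>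
     converse (Gamma_graph Dom G0 G1) = krein_adjoint (Gamma_graph Dom G0 G1)"

definition unitary_boundary_triple ::
  "('h::complex_inner \<times> 'h) set \<Rightarrow> ('h \<times> 'h) set \<Rightarrow> ('h \<times> 'h \<Rightarrow> 'k::complex_inner) \<Rightarrow> ('h \<times> 'h \<Rightarrow> 'k) \<Rightarrow> bool" where
  "unitary_boundary_triple A Dom G0 G1 \<longleftrightarrow>
     csubspace A \<and> hclosed A \<and> symmetric_rel A \<and>
     unitary_bt Dom G0 G1 \<and> Dom \<subseteq> radjoint A \<and> radjoint A \<subseteq> hclosure Dom"

definition A0_rel :: "('h \<times> 'h) set \<Rightarrow> ('h \<times> 'h \<Rightarrow> 'k::zero) \<Rightarrow> ('h \<times> 'h) set" where
  "A0_rel Dom G0 = {fh \<in> Dom. G0 fh = 0}"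

definition defect_hat :: "('h::complex_inner \<times> 'h) set \<Rightarrow> complex \<Rightarrow> ('h \<times> 'h) set" where
  "defect_hat Dom z = {fh \<in> Dom. snd fh = z *\<^sub>C fst fh}"

definition weyl_rel ::
  "('h::complex_inner \<times> 'h) set \<Rightarrow> ('h \<times> 'h \<Rightarrow> 'k) \<Rightarrow> ('h \<times> 'h \<Rightarrow> 'k) \<Rightarrow> complex \<Rightarrow> ('k \<times> 'k) set" where
  "weyl_rel Dom G0 G1 z = {(G0 fh, G1 fh) | fh. fh \<in> defect_hat Dom z}"

definition gamma_rel ::
  "('h::complex_inner \<times> 'h) set \<Rightarrow> ('h \<times> 'h \<Rightarrow> 'k) \<Rightarrow> complex \<Rightarrow> ('k \<times> 'h) set" where
  "gamma_rel Dom G0 z = {(G0 fh, fst fh) | fh. fh \<in> defect_hat Dom z}"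

definition op_app :: "('a \<times> 'b) set \<Rightarrow> 'a \<Rightarrow> 'b" where
  "op_app T u = (SOME v. (u, v) \<in> T)"

text \<open>A sesquilinear form is given by its domain and its values.\<close>

type_synonym 'a sform = "'a set \<times> ('a \<Rightarrow> 'a \<Rightarrow> complex)"

definition form_cauchy :: "'a::complex_inner sform \<Rightarrow> (nat \<Rightarrow> 'a) \<Rightarrow> bool" where
  "form_cauchy t X \<longleftrightarrow> (\<forall>e>0. \<exists>N. \<forall>m\<ge>N. \<forall>n\<ge>N. cmod (snd t (X n - X m) (X n - X m)) < e)"

definition form_closable :: "'a::complex_inner sform \<Rightarrow> bool" where
  "form_closable t \<longleftrightarrow> (\<forall>X. (\<forall>n. X n \<in> fst t) \<and> cconv X 0 \<and> form_cauchy t X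
       \<longrightarrow> (\<lambda>n. snd t (X n) (X n)) \<longlonglongrightarrow> 0)"

definition form_closure_dom :: "'a::complex_inner sform \<Rightarrow> 'a set" where
  "form_closure_dom t = {u. \<exists>X. (\<forall>n. X n \<in> fst t) \<and> cconv X u \<and> form_cauchy t X}"

definition form_of :: "('k::complex_inner \<times> 'k) set \<Rightarrow> complex \<Rightarrow> 'k sform" where
  "form_of M z = (Domain M,
     \<lambda>u v. (cinner (op_app M u) v - cinner u (op_app M v)) / (z - cnj z))"

definition form_domain_invariant :: "(complex \<Rightarrow> ('k::complex_inner \<times> 'k) set) \<Rightarrow> complex set \<Rightarrow> bool" where
  "form_domain_invariant M U \<longleftrightarrow> (\<forall>z\<in>U. form_closable (form_of (M z) z)) \<and>
     (\<forall>z\<in>U. \<forall>\<mu>\<in>U. form_closure_dom (form_of (M z) z) = form_closure_dom (form_of (M \<mu>) \<mu>))"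

definition res_rel :: "('k::complex_inner \<times> 'k) set \<Rightarrow> complex \<Rightarrow> ('k \<times> 'k) set" where
  "res_rel T \<mu> = {(f' + \<mu> *\<^sub>C f, f) | f f'. (f, f') \<in> T}"

definition nevanlinna_R :: "(complex \<Rightarrow> ('k::complex_inner \<times> 'k) set) \<Rightarrow> bool" where
  "nevanlinna_R F \<longleftrightarrow>
     (\<forall>z. Im z \<noteq> 0 \<longrightarrow> csubspace (F z) \<and> is_operator (F z) \<and> hclosed (F z)) \<and>
     (\<forall>z. Im z > 0 \<longrightarrow> max_dissipative (F z)) \<and>
     (\<forall>z. Im z \<noteq> 0 \<longrightarrow> radjoint (F z) = F (cnj z)) \<and>
     (\<exists>\<mu>. Im \<mu> > 0 \<and> (\<forall>z. Im z > 0 \<longrightarrow> Domain (res_rel (F z) \<mu>) = UNIV) \<and>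
        (\<forall>u v. (\<lambda>z. cinner (op_app (res_rel (F z) \<mu>) u) v) holomorphic_on {z. Im z > 0}))"

definition nevanlinna_Rs :: "(complex \<Rightarrow> ('k::complex_inner \<times> 'k) set) \<Rightarrow> bool" where
  "nevanlinna_Rs F \<longleftrightarrow> nevanlinna_R F \<and>
     (\<forall>h h'. (h, h') \<in> F \<i> \<and> Im (cinner h' h) = 0 \<longrightarrow> h = 0)"

end

theory Submission
  imports Defs
begin

text \<open>
  The graph of \<open>\<Gamma>\<close>, suitably rearranged, is a selfadjoint relation in \<open>\<HH> \<times> \<H>\<close> (the main transform).
  Hence, for \<open>Im z\<close> and \<open>Im \<mu>\<close> of the same sign, the boundary problem \<open>f' - z f = a\<close>,
  \<open>\<Gamma>\<^sub>1 f + \<mu> \<Gamma>\<^sub>0 f = b\<close> has a unique solution, depending boundedly on \<open>a, b\<close>. The case \<open>a = 0\<close> gives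
  \<open>M \<in> R\<^sup>s\<close> for every unitary triple.

  The forms reduce to \<open>\<gamma>\<close>, since \<open>t\<^bsub>M(z)\<^esub>[u,v] = (\<gamma>(z)u, \<gamma>(z)v)\<close>. The boundary problem shows
  \<open>dom \<gamma>(z)\<^sup>* \<subseteq> ran (A\<^sub>0 - cnj z)\<close>, so closability of \<open>\<gamma>(\<plusminus>\<i>)\<close> makes both ranges \<open>ran (A\<^sub>0 \<plusminus> \<i>)\<close> dense.
  Conversely a limit of defect elements with \<open>\<Gamma>\<^sub>0 \<rightarrow> 0\<close> lies in \<open>A\<^sub>0\<^sup>*\<close>. For the domains, any \<open>f \<in> dom \<Gamma>\<close> is
  corrected by an element of \<open>A\<^sub>0\<close> with nearly the same \<open>f' - z f\<close> and then by a small solution of the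
  boundary problem, which lands in the defect space and hardly changes \<open>\<Gamma>\<^sub>0\<close>.
\<close>

section \<open>Complex inner product spaces\<close>

lemma scaleC_zero_left [simp]: "0 *\<^sub>C x = (0::'a::complex_inner)"
  using scaleC_add_left[of 0 0 x] by simp

lemma scaleC_zero_right [simp]: "a *\<^sub>C 0 = (0::'a::complex_inner)"
  using scaleC_add_right[of a 0 0] by simp

lemma scaleC_minus_left: "(- a) *\<^sub>C x = - (a *\<^sub>C (x::'a::complex_inner))"
  using scaleC_add_left[of "-a" a x] by (simp add: eq_neg_iff_add_eq_0)

lemma scaleC_minus_right: "a *\<^sub>C (- x) = - (a *\<^sub>C (x::'a::complex_inner))"
  using scaleC_add_right[of a "-x" x] by (simp add: eq_neg_iff_add_eq_0)

lemma scaleC_diff_left: "(a - b) *\<^sub>C x = a *\<^sub>C x - b *\<^sub>C (x::'a::complex_inner)"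
  using scaleC_add_left[of a "-b" x] by (simp add: scaleC_minus_left)

lemma scaleC_diff_right: "a *\<^sub>C (x - y) = a *\<^sub>C x - a *\<^sub>C (y::'a::complex_inner)"
  using scaleC_add_right[of a x "-y"] by (simp add: scaleC_minus_right)

lemma cinner_zero_left [simp]: "cinner 0 x = 0"
  using cinner_scaleC_left[of 0 0 x] by simp

lemma cinner_zero_right [simp]: "cinner x 0 = 0"
  using cinner_commute[of x 0] by simp

lemma cinner_minus_left: "cinner (- x) y = - cinner x y"
  using cinner_add_left[of "-x" x y] by (simp add: eq_neg_iff_add_eq_0)

lemma cinner_diff_left: "cinner (x - y) z = cinner x z - cinner y z"
  using cinner_add_left[of x "-y" z] by (simp add: cinner_minus_left)

lemma cinner_add_right: "cinner x (y + z) = cinner x y + cinner x z"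
  by (subst (1 2 3) cinner_commute) (simp add: cinner_add_left)

lemma cinner_minus_right: "cinner x (- y) = - cinner x y"
  by (subst (1 2) cinner_commute) (simp add: cinner_minus_left)

lemma cinner_diff_right: "cinner x (y - z) = cinner x y - cinner x z"
  using cinner_add_right[of x y "-z"] by (simp add: cinner_minus_right)

lemma cinner_scaleC_right: "cinner x (a *\<^sub>C y) = cnj a * cinner x y"
  by (subst (1 2) cinner_commute) (simp add: cinner_scaleC_left)

lemmas cinner_simps = cinner_add_left cinner_add_right cinner_diff_left cinner_diff_right
  cinner_minus_left cinner_minus_right cinner_scaleC_left cinner_scaleC_right

lemmas scaleC_simps = scaleC_add_left scaleC_add_right scaleC_diff_left scaleC_diff_right
  scaleC_minus_left scaleC_minus_right scaleC_scaleC scaleC_one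

lemma cnorm_nonneg [simp]: "cnorm x \<ge> 0"
  by (simp add: cnorm_def cinner_self_nonneg)

lemma cnorm_power2: "(cnorm x)\<^sup>2 = Re (cinner x x)"
  by (simp add: cnorm_def cinner_self_nonneg)

lemma cinner_self: "cinner x x = of_real ((cnorm x)\<^sup>2)"
  by (simp add: cnorm_power2 complex_eq_iff cinner_self_real)

lemma cnorm_eq_zero_iff [simp]: "cnorm x = 0 \<longleftrightarrow> x = 0"
  using cinner_self_eq_zero[of x] by (simp add: cinner_self)

lemma cnorm_le_zero_iff [simp]: "cnorm x \<le> 0 \<longleftrightarrow> x = 0"
  using cnorm_nonneg[of x] cnorm_eq_zero_iff[of x] by linarith

lemma cnorm_zero [simp]: "cnorm 0 = 0"
  by (simp add: cnorm_def)

lemma cnorm_scaleC: "cnorm (a *\<^sub>C x) = cmod a * cnorm x"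
proof -
  have "cinner (a *\<^sub>C x) (a *\<^sub>C x) = (a * cnj a) * cinner x x"
    by (simp add: cinner_simps)
  also have "\<dots> = of_real ((cmod a * cnorm x)\<^sup>2)"
    by (simp add: cinner_self[of x] power_mult_distrib flip: complex_norm_square)
  finally have "(cnorm (a *\<^sub>C x))\<^sup>2 = (cmod a * cnorm x)\<^sup>2"
    unfolding cnorm_power2 by (metis Re_complex_of_real)
  then show ?thesis
    by (simp add: power2_eq_iff_nonneg)
qed

lemma cnorm_minus [simp]: "cnorm (- x) = cnorm x"
  by (simp add: cnorm_def cinner_simps)

lemma cnorm_minus_commute: "cnorm (x - y) = cnorm (y - x)"
  using cnorm_minus[of "x - y"] by simp

lemma Cauchy_Schwarz_cinner: "cmod (cinner x y) \<le> cnorm x * cnorm y"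
proof (cases "y = 0")
  case False
  define n where "n = (cnorm y)\<^sup>2"
  have n: "n > 0"
    using False by (simp add: n_def)
  define c where "c = cinner x y"
  have yx: "cinner y x = cnj c"
    by (simp add: c_def cinner_commute[of y x])
  have cc: "c * cnj c = of_real ((cmod c)\<^sup>2)"
    using complex_norm_square[of c] by simp
  have yy: "cinner y y = of_real n"
    by (simp only: cinner_self n_def)
  \<comment> \<open>This is |y|^2 times the component of x orthogonal to y. Multiplying through by
    |y|^2 avoids a division.\<close>
  define w where "w = of_real n *\<^sub>C x - c *\<^sub>C y"
  have "cinner w w = of_real n * of_real n * cinner x x - of_real n * (c * cnj c)"
    by (simp add: w_def cinner_simps yx yy c_def[symmetric] algebra_simps)
  also have "\<dots> = of_real (n * (n * (cnorm x)\<^sup>2 - (cmod c)\<^sup>2))"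
    unfolding cc cinner_self[of x] by (simp add: algebra_simps)
  finally have "(cnorm w)\<^sup>2 = n * (n * (cnorm x)\<^sup>2 - (cmod c)\<^sup>2)"
    unfolding cnorm_power2[of w] by (metis Re_complex_of_real)
  then have "n * (n * (cnorm x)\<^sup>2 - (cmod c)\<^sup>2) \<ge> 0"
    by (metis zero_le_power2)
  then have "(cmod c)\<^sup>2 \<le> (cnorm x * cnorm y)\<^sup>2"
    using n by (simp add: zero_le_mult_iff n_def power_mult_distrib mult.commute)
  then show ?thesis
    unfolding c_def by (rule power2_le_imp_le) simp
qed simp

lemma cnorm_add_power2: "(cnorm (x + y))\<^sup>2 = (cnorm x)\<^sup>2 + (cnorm y)\<^sup>2 + 2 * Re (cinner x y)"
  unfolding cnorm_power2 using cinner_commute[of y x] by (simp add: cinner_simps)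

lemma cnorm_triangle: "cnorm (x + y) \<le> cnorm x + cnorm y"
proof (rule power2_le_imp_le)
  have "Re (cinner x y) \<le> cnorm x * cnorm y"
    using Cauchy_Schwarz_cinner[of x y] complex_Re_le_cmod[of "cinner x y"] by linarith
  then show "(cnorm (x + y))\<^sup>2 \<le> (cnorm x + cnorm y)\<^sup>2"
    by (simp add: cnorm_add_power2 power2_sum)
qed simp

lemma cnorm_triangle_via: "cnorm (x - z) \<le> cnorm (x - y) + cnorm (y - z)"
  using cnorm_triangle[of "x - y" "y - z"] by simp

lemma parallelogram: "(cnorm (x + y))\<^sup>2 + (cnorm (x - y))\<^sup>2 = 2 * (cnorm x)\<^sup>2 + 2 * (cnorm y)\<^sup>2"
  using cnorm_add_power2[of x y] cnorm_add_power2[of x "-y"] by (simp add: cinner_simps)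

section \<open>Convergence and closures\<close>

lemma cconv_iff: "cconv X x \<longleftrightarrow> (\<forall>e>0. \<exists>N. \<forall>n\<ge>N. cnorm (X n - x) < e)"
  by (simp add: cconv_def LIMSEQ_def dist_real_def)

lemma cconv_comparison:
  assumes "b \<longlonglongrightarrow> 0" "\<And>n. cnorm (X n - x) \<le> b n"
  shows "cconv X x"
  unfolding cconv_def by (rule Lim_null_comparison[OF _ assms(1)]) (simp add: assms(2))

lemma cconv_const [simp]: "cconv (\<lambda>n. x) x"
  by (simp add: cconv_def)

lemma cconv_add:
  assumes "cconv X x" "cconv Y y"
  shows "cconv (\<lambda>n. X n + Y n) (x + y)"
proof (rule cconv_comparison)
  show "(\<lambda>n. cnorm (X n - x) + cnorm (Y n - y)) \<longlonglongrightarrow> 0"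
    using tendsto_add[OF assms[unfolded cconv_def]] by simp
  show "cnorm (X n + Y n - (x + y)) \<le> cnorm (X n - x) + cnorm (Y n - y)" for n
    using cnorm_triangle[of "X n - x" "Y n - y"] by (simp add: algebra_simps)
qed

lemma cconv_minus: "cconv X x \<Longrightarrow> cconv (\<lambda>n. - X n) (- x)"
  unfolding cconv_def by (simp add: cnorm_minus_commute)

lemma cconv_diff: "cconv X x \<Longrightarrow> cconv Y y \<Longrightarrow> cconv (\<lambda>n. X n - Y n) (x - y)"
  using cconv_add[OF _ cconv_minus, of X x Y y] by simp

lemma cconv_lipschitz:
  assumes "cconv X x" "\<And>y z. cnorm (F y - F z) \<le> c * cnorm (y - z)"
  shows "cconv (\<lambda>n. F (X n)) (F x)"
proof (rule cconv_comparison)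
  show "(\<lambda>n. c * cnorm (X n - x)) \<longlonglongrightarrow> 0"
    using tendsto_mult_left[OF assms(1)[unfolded cconv_def], of c] by simp
qed (rule assms(2))

lemma cconv_scaleC: "cconv X x \<Longrightarrow> cconv (\<lambda>n. a *\<^sub>C X n) (a *\<^sub>C x)"
  by (rule cconv_lipschitz[where c = "cmod a"]) 
    (auto simp: scaleC_diff_right[symmetric] cnorm_scaleC)

lemma tendsto_cinner_left:
  assumes "cconv X x"
  shows "(\<lambda>n. cinner (X n) y) \<longlonglongrightarrow> cinner x y"
proof (subst LIM_zero_iff[symmetric], rule Lim_null_comparison)
  show "(\<lambda>n. cnorm (X n - x) * cnorm y) \<longlonglongrightarrow> 0"
    using tendsto_mult_right[OF assms[unfolded cconv_def], of "cnorm y"] by simp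
  show "\<forall>\<^sub>F n in sequentially. cmod (cinner (X n) y - cinner x y) \<le> cnorm (X n - x) * cnorm y"
    using Cauchy_Schwarz_cinner[of "X _ - x" y] by (simp add: cinner_simps)
qed

lemma tendsto_cinner_right:
  assumes "cconv X x"
  shows "(\<lambda>n. cinner y (X n)) \<longlonglongrightarrow> cinner y x"
  using tendsto_cnj[OF tendsto_cinner_left[OF assms, of y]]
  by (simp add: cinner_commute[of y])

lemma tendsto_cnorm:
  assumes "cconv X x"
  shows "(\<lambda>n. cnorm (X n)) \<longlonglongrightarrow> cnorm x"
proof (subst LIM_zero_iff[symmetric], rule Lim_null_comparison)
  show "(\<lambda>n. cnorm (X n - x)) \<longlonglongrightarrow> 0"
    using assms by (simp add: cconv_def)
  have "\<bar>cnorm y - cnorm x\<bar> \<le> cnorm (y - x)" for y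
    using cnorm_triangle[of "y - x" x] cnorm_triangle[of "x - y" y]
    by (simp add: cnorm_minus_commute[of x y])
  then show "\<forall>\<^sub>F n in sequentially. norm (cnorm (X n) - cnorm x) \<le> cnorm (X n - x)"
    by simp
qed

lemma cconv_imp_ccauchy:
  assumes "cconv X x"
  shows "ccauchy X"
  unfolding ccauchy_def
proof (intro allI impI)
  fix e :: real
  assume "e > 0"
  then obtain N where N: "\<And>n. n \<ge> N \<Longrightarrow> cnorm (X n - x) < e / 2"
    using assms half_gt_zero unfolding cconv_iff by blast
  have "cnorm (X m - X n) < e" if "m \<ge> N" "n \<ge> N" for m n
    using N[OF that(1)] N[OF that(2)] cnorm_triangle_via[of "X m" "X n" x]
    by (simp add: cnorm_minus_commute[of x])
  then show "\<exists>N. \<forall>m\<ge>N. \<forall>n\<ge>N. cnorm (X m - X n) < e"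
    by blast
qed

lemma ccauchy_convergent:
  fixes X :: "nat \<Rightarrow> 'a::complex_hilbert"
  shows "ccauchy X \<Longrightarrow> \<exists>x. cconv X x"
  using complete_cinner[of X] unfolding ccauchy_def cconv_def cnorm_def by simp

text \<open>Used with a lower bound on an operator to pull convergence of images back to their
  preimages, and with c = 1 for the coordinates of a product.\<close>

lemma ccauchy_bounded_by:
  assumes "ccauchy Y" "c > 0" "\<And>m n. c * cnorm (X m - X n) \<le> cnorm (Y m - Y n)"
  shows "ccauchy X"
  unfolding ccauchy_def
proof (intro allI impI)
  fix e :: real
  assume "e > 0"
  then obtain N where N: "\<And>m n. m \<ge> N \<Longrightarrow> n \<ge> N \<Longrightarrow> cnorm (Y m - Y n) < c * e"
    using assms(1) \<open>c > 0\<close> unfolding ccauchy_def by (metis mult_pos_pos)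
  have "cnorm (X m - X n) < e" if "m \<ge> N" "n \<ge> N" for m n
    using le_less_trans[OF assms(3) N[OF that]] \<open>c > 0\<close> by simp
  then show "\<exists>N. \<forall>m\<ge>N. \<forall>n\<ge>N. cnorm (X m - X n) < e"
    by blast
qed

lemma fst_scaleC: "fst (a *\<^sub>C x) = a *\<^sub>C fst x"
  and snd_scaleC: "snd (a *\<^sub>C x) = a *\<^sub>C snd x"
  and scaleC_Pair: "a *\<^sub>C (y, z) = (a *\<^sub>C y, a *\<^sub>C z)"
  by (simp_all add: scaleC_prod_def)

lemma cnorm_prod_power2: "(cnorm x)\<^sup>2 = (cnorm (fst x))\<^sup>2 + (cnorm (snd x))\<^sup>2"
  by (simp add: cnorm_power2 cinner_prod_def)

lemma cnorm_fst_le: "cnorm (fst x) \<le> cnorm x"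
  by (rule power2_le_imp_le) (simp_all add: cnorm_prod_power2[of x])

lemma cnorm_snd_le: "cnorm (snd x) \<le> cnorm x"
  by (rule power2_le_imp_le) (simp_all add: cnorm_prod_power2[of x])

lemma cnorm_prod_le: "cnorm x \<le> cnorm (fst x) + cnorm (snd x)"
  by (rule power2_le_imp_le) (simp_all add: cnorm_prod_power2[of x] power2_sum)

lemma cconv_fst: "cconv X x \<Longrightarrow> cconv (\<lambda>n. fst (X n)) (fst x)"
  by (rule cconv_lipschitz[where c = 1]) (simp_all add: cnorm_fst_le flip: fst_diff)

lemma cconv_snd: "cconv X x \<Longrightarrow> cconv (\<lambda>n. snd (X n)) (snd x)"
  by (rule cconv_lipschitz[where c = 1]) (simp_all add: cnorm_snd_le flip: snd_diff)

lemma cconv_Pair: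
  assumes "cconv X x" "cconv Y y"
  shows "cconv (\<lambda>n. (X n, Y n)) (x, y)"
proof (rule cconv_comparison)
  show "(\<lambda>n. cnorm (X n - x) + cnorm (Y n - y)) \<longlonglongrightarrow> 0"
    using tendsto_add[OF assms[unfolded cconv_def]] by simp
  show "cnorm ((X n, Y n) - (x, y)) \<le> cnorm (X n - x) + cnorm (Y n - y)" for n
    using cnorm_prod_le[of "(X n, Y n) - (x, y)"] by simp
qed

text \<open>Graphs are subspaces of products and the main transform acts in \<HH> \<times> \<H>, so
  the projection and range arguments below have to be run in product spaces.\<close>

instance prod :: (complex_hilbert, complex_hilbert) complex_hilbert
proof
  fix X :: "nat \<Rightarrow> 'a \<times> 'b"
  assume "\<forall>e>0. \<exists>N. \<forall>m\<ge>N. \<forall>n\<ge>N. sqrt (Re (cinner (X m - X n) (X m - X n))) < e"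
  then have X: "ccauchy X"
    by (simp add: ccauchy_def cnorm_def)
  have "ccauchy (\<lambda>n. fst (X n))" "ccauchy (\<lambda>n. snd (X n))"
    by (rule ccauchy_bounded_by[OF X, where c = 1];
        simp add: cnorm_fst_le cnorm_snd_le flip: fst_diff snd_diff)+
  then obtain a b where "cconv (\<lambda>n. fst (X n)) a" "cconv (\<lambda>n. snd (X n)) b"
    by (meson ccauchy_convergent)
  then have "cconv X (a, b)"
    using cconv_Pair by fastforce
  then show "\<exists>L. (\<lambda>n. sqrt (Re (cinner (X n - L) (X n - L)))) \<longlonglongrightarrow> 0"
    unfolding cconv_def cnorm_def by blast
next
  obtain D :: "'a set" where D: "countable D" "\<And>x e. e > 0 \<Longrightarrow> \<exists>d\<in>D. cnorm (x - d) < e"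
    using separable_cinner unfolding cnorm_def by metis
  obtain E :: "'b set" where E: "countable E" "\<And>x e. e > 0 \<Longrightarrow> \<exists>d\<in>E. cnorm (x - d) < e"
    using separable_cinner unfolding cnorm_def by metis
  have "\<exists>p\<in>D \<times> E. cnorm (x - p) < e" if e: "e > 0" for x e
  proof -
    obtain d where "d \<in> D" "cnorm (fst x - d) < e / 2"
      using D(2)[OF half_gt_zero[OF e]] by blast
    moreover obtain d' where "d' \<in> E" "cnorm (snd x - d') < e / 2"
      using E(2)[OF half_gt_zero[OF e]] by blast
    ultimately have d: "d \<in> D" "d' \<in> E" "cnorm (fst x - d) < e / 2" "cnorm (snd x - d') < e / 2"
      by simp_all
    then have "cnorm (x - (d, d')) < e"
      using cnorm_prod_le[of "x - (d, d')"] by simp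
    then show ?thesis
      using d by blast
  qed
  then show "\<exists>D. countable D \<and>
      (\<forall>x::'a \<times> 'b. \<forall>e>0. \<exists>d\<in>D. sqrt (Re (cinner (x - d) (x - d))) < e)"
    using countable_SIGMA[of D "\<lambda>_. E"] D(1) E(1) unfolding cnorm_def by blast
qed

lemma hclosureI: "(\<And>n. X n \<in> S) \<Longrightarrow> cconv X x \<Longrightarrow> x \<in> hclosure S"
  unfolding hclosure_def by blast

lemma hclosureE:
  assumes "x \<in> hclosure S"
  obtains X where "\<And>n. X n \<in> S" "cconv X x"
  using assms unfolding hclosure_def by blast

lemma hclosure_superset: "S \<subseteq> hclosure S"
  by (auto intro: hclosureI[where X = "\<lambda>n. _"])

lemma csubspace_0: "csubspace S \<Longrightarrow> 0 \<in> S"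
  and csubspace_add: "csubspace S \<Longrightarrow> x \<in> S \<Longrightarrow> y \<in> S \<Longrightarrow> x + y \<in> S"
  and csubspace_scaleC: "csubspace S \<Longrightarrow> x \<in> S \<Longrightarrow> a *\<^sub>C x \<in> S"
  by (auto simp: csubspace_def)

lemma csubspace_diff: "csubspace S \<Longrightarrow> x \<in> S \<Longrightarrow> y \<in> S \<Longrightarrow> x - y \<in> S"
  using csubspace_add[of S x "(-1) *\<^sub>C y"] csubspace_scaleC[of S y "-1"]
  by (simp add: scaleC_minus_left scaleC_one)

lemma csubspace_linear_image:
  assumes S: "csubspace S" and add: "\<And>f g. f \<in> S \<Longrightarrow> g \<in> S \<Longrightarrow> F (f + g) = F f + F g"
    and scaleC: "\<And>a f. f \<in> S \<Longrightarrow> F (a *\<^sub>C f) = a *\<^sub>C F f"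
  shows "csubspace (F ` S)"
  unfolding csubspace_def
proof (intro conjI ballI allI)
  show "0 \<in> F ` S"
    using scaleC[OF csubspace_0[OF S], of 0] csubspace_0[OF S] by (metis image_eqI scaleC_zero_left)
next
  fix x y
  assume "x \<in> F ` S" "y \<in> F ` S"
  then show "x + y \<in> F ` S"
    using add csubspace_add[OF S] by (smt (verit) image_iff)
next
  fix a x
  assume "x \<in> F ` S"
  then show "a *\<^sub>C x \<in> F ` S"
    using scaleC csubspace_scaleC[OF S] by (smt (verit) image_iff)
qed

section \<open>Orthogonal projection\<close>

lemma orthogonal_of_minimal:
  assumes "\<And>c. cnorm v \<le> cnorm (v - c *\<^sub>C s)"
  shows "cinner s v = 0"
proof (cases "s = 0")
  case False
  define n where "n = (cnorm s)\<^sup>2"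
  have n: "n > 0"
    using False by (simp add: n_def)
  define b where "b = cinner v s"
  have sv: "cinner s v = cnj b"
    by (simp add: b_def cinner_commute[of s v])
  have bb: "b * cnj b = of_real ((cmod b)\<^sup>2)"
    using complex_norm_square[of b] by simp
  \<comment> \<open>The coefficient of the projection of v onto s. It lowers |v|^2 by exactly
    |b|^2/n, so minimality forces b = 0.\<close>
  define c where "c = b / of_real n"
  have "c * cinner s v = of_real ((cmod b)\<^sup>2 / n)"
    using bb by (simp add: c_def sv)
  moreover have "cnj c * cinner v s = of_real ((cmod b)\<^sup>2 / n)"
    using bb by (simp add: c_def b_def[symmetric] mult.commute)
  moreover have "c * (cnj c * cinner s s) = of_real ((cmod b)\<^sup>2 / n)"
    using bb n by (simp add: c_def cinner_self[of s] n_def[symmetric])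
  ultimately have "cinner (v - c *\<^sub>C s) (v - c *\<^sub>C s) = cinner v v - of_real ((cmod b)\<^sup>2 / n)"
    by (simp add: cinner_simps algebra_simps)
  then have "(cnorm (v - c *\<^sub>C s))\<^sup>2 = (cnorm v)\<^sup>2 - (cmod b)\<^sup>2 / n"
    unfolding cnorm_power2 by (metis Re_complex_of_real minus_complex.simps(1))
  moreover have "(cnorm v)\<^sup>2 \<le> (cnorm (v - c *\<^sub>C s))\<^sup>2"
    using assms by (simp add: power_mono)
  ultimately have "(cmod b)\<^sup>2 / n \<le> 0"
    by simp
  then have "b = 0"
    using n by (simp add: divide_le_0_iff)
  then show ?thesis
    by (simp add: sv)
qed simp

lemma minimizing_sequence_ccauchy:
  assumes S: "csubspace S" and min: "\<And>s. s \<in> S \<Longrightarrow> d \<le> cnorm (x - s)" and "d \<ge> 0"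
    and X: "\<And>n. X n \<in> S" and lim: "(\<lambda>n. cnorm (x - X n)) \<longlonglongrightarrow> d"
  shows "ccauchy X"
proof -
  have key: "(cnorm (X m - X n))\<^sup>2
      \<le> 2 * ((cnorm (x - X m))\<^sup>2 - d\<^sup>2) + 2 * ((cnorm (x - X n))\<^sup>2 - d\<^sup>2)" for m n
  proof -
    \<comment> \<open>The midpoint of X m and X n lies in S, hence has distance at least d from x.
      The parallelogram law turns this into a bound on X m - X n.\<close>
    define s where "s = (1/2) *\<^sub>C (X m + X n)"
    have "s \<in> S"
      using S X by (simp add: s_def csubspace_add csubspace_scaleC)
    have "2 *\<^sub>C s = X m + X n"
      by (simp add: s_def scaleC_simps)
    moreover have "2 *\<^sub>C x = x + x"
      using scaleC_add_left[of 1 1 x] by (simp add: scaleC_one)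
    ultimately have "(x - X n) + (x - X m) = 2 *\<^sub>C (x - s)"
      by (simp add: scaleC_diff_right)
    then have "cnorm ((x - X n) + (x - X m)) = 2 * cnorm (x - s)"
      by (simp add: cnorm_scaleC)
    moreover have "d\<^sup>2 \<le> (cnorm (x - s))\<^sup>2"
      using min[OF \<open>s \<in> S\<close>] \<open>d \<ge> 0\<close> by (rule power_mono)
    ultimately show ?thesis
      using parallelogram[of "x - X n" "x - X m"] by (simp add: power_mult_distrib)
  qed
  have lim2: "(\<lambda>n. (cnorm (x - X n))\<^sup>2) \<longlonglongrightarrow> d\<^sup>2"
    using lim by (rule tendsto_power)
  show ?thesis
    unfolding ccauchy_def
  proof (intro allI impI)
    fix e :: real
    assume "e > 0"
    then obtain N where N: "\<And>n. n \<ge> N \<Longrightarrow> \<bar>(cnorm (x - X n))\<^sup>2 - d\<^sup>2\<bar> < e\<^sup>2 / 4"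
      using lim2 unfolding LIMSEQ_def dist_real_def
      by (metis zero_less_divide_iff zero_less_numeral zero_less_power)
    have "cnorm (X m - X n) < e" if "m \<ge> N" "n \<ge> N" for m n
    proof (rule power2_less_imp_less)
      show "(cnorm (X m - X n))\<^sup>2 < e\<^sup>2"
        using key[of m n] N[OF that(1)] N[OF that(2)] by argo
    qed (use \<open>e > 0\<close> in simp)
    then show "\<exists>N. \<forall>m\<ge>N. \<forall>n\<ge>N. cnorm (X m - X n) < e"
      by blast
  qed
qed

text \<open>A minimizing sequence in S converges to some L, and v = x - L is orthogonal to S by
  minimality, hence to L by continuity. The hypothesis makes x orthogonal to v as well, so (v, v) =
  0 and x = L.\<close>

lemma mem_hclosure_if_biorthogonal:
  fixes S :: "'a::complex_hilbert set"
  assumes S: "csubspace S"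
    and orth: "\<And>v. (\<And>s. s \<in> S \<Longrightarrow> cinner s v = 0) \<Longrightarrow> cinner x v = 0"
  shows "x \<in> hclosure S"
proof -
  define d where "d = (INF s\<in>S. cnorm (x - s))"
  have ne: "S \<noteq> {}"
    using csubspace_0[OF S] by blast
  have bdd: "bdd_below ((\<lambda>s. cnorm (x - s)) ` S)"
    by (rule bdd_belowI[of _ 0]) auto
  have min: "d \<le> cnorm (x - s)" if "s \<in> S" for s
    unfolding d_def using bdd that by (rule cINF_lower)
  have "d \<ge> 0"
    unfolding d_def using ne by (rule cINF_greatest) simp
  have "\<exists>s\<in>S. cnorm (x - s) < d + inverse (real (Suc n))" for n
    using cInf_lessD[of "(\<lambda>s. cnorm (x - s)) ` S" "d + inverse (real (Suc n))"] ne
    by (auto simp: d_def simp del: of_nat_Suc)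
  then obtain X where X: "\<And>n. X n \<in> S" "\<And>n. cnorm (x - X n) < d + inverse (real (Suc n))"
    by metis
  have lim: "(\<lambda>n. cnorm (x - X n)) \<longlonglongrightarrow> d"
  proof (rule tendsto_sandwich[where f = "\<lambda>_. d"])
    show "(\<lambda>n. d + inverse (real (Suc n))) \<longlonglongrightarrow> d"
      using tendsto_add[OF tendsto_const LIMSEQ_inverse_real_of_nat, of d] by simp
  qed (use min X in \<open>auto simp: less_imp_le simp del: of_nat_Suc\<close>)
  obtain L where L: "cconv X L"
    using ccauchy_convergent minimizing_sequence_ccauchy[OF S min \<open>d \<ge> 0\<close> X(1) lim] by blast
  define v where "v = x - L"
  have vlim: "cconv (\<lambda>n. x - X n) v"
    unfolding v_def by (intro cconv_diff cconv_const L)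
  have "cnorm v = d"
    using LIMSEQ_unique[OF tendsto_cnorm[OF vlim] lim] .
  have sv: "cinner s v = 0" if "s \<in> S" for s
  proof (rule orthogonal_of_minimal)
    fix c
    have "(\<lambda>n. cnorm (x - X n - c *\<^sub>C s)) \<longlonglongrightarrow> cnorm (v - c *\<^sub>C s)"
      by (intro tendsto_cnorm cconv_diff vlim cconv_const)
    moreover have "d \<le> cnorm (x - X n - c *\<^sub>C s)" for n
      using min[of "X n + c *\<^sub>C s"] S X(1) that
      by (simp add: csubspace_add csubspace_scaleC algebra_simps)
    ultimately show "cnorm v \<le> cnorm (v - c *\<^sub>C s)"
      unfolding \<open>cnorm v = d\<close> by (intro LIMSEQ_le_const) auto
  qed
  have "cinner L v = 0"
    using LIMSEQ_unique[OF tendsto_cinner_left[OF L, of v], of 0] sv X(1) by simp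
  then have "cinner v v = 0"
    using orth[OF sv] by (simp add: v_def cinner_diff_left)
  then have "x = L"
    by (simp add: cinner_self_eq_zero v_def)
  then show ?thesis
    using hclosureI[OF X(1) L] by simp
qed

section \<open>Linear relations\<close>

lemma op_app_eq: "is_operator T \<Longrightarrow> (u, v) \<in> T \<Longrightarrow> op_app T u = v"
  unfolding op_app_def is_operator_def by (rule some_equality) blast+

lemma radjoint_iff:
  "(k, k') \<in> radjoint T \<longleftrightarrow> (\<forall>f f'. (f, f') \<in> T \<longrightarrow> cinner f' k = cinner f k')"
  by (auto simp: radjoint_def)

lemma hclosed_radjoint: "hclosure (radjoint T) = radjoint T"
proof (rule antisym[OF _ hclosure_superset], safe)
  fix k k'
  assume "(k, k') \<in> hclosure (radjoint T)"
  then obtain X where X: "\<And>n. X n \<in> radjoint T" "cconv X (k, k')"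
    using hclosureE by blast
  show "(k, k') \<in> radjoint T"
    unfolding radjoint_iff
  proof (intro allI impI)
    fix f f'
    assume "(f, f') \<in> T"
    then have "cinner f' (fst (X n)) = cinner f (snd (X n))" for n
      using X(1)[of n] by (metis prod.collapse radjoint_iff)
    then show "cinner f' k = cinner f k'"
      using LIMSEQ_unique[OF tendsto_cinner_right[OF cconv_fst[OF X(2)], of f']]
        tendsto_cinner_right[OF cconv_snd[OF X(2)], of f] by simp
  qed
qed

lemma csubspace_radjoint: "csubspace (radjoint T)"
  unfolding csubspace_def
proof (intro conjI ballI allI)
  show "0 \<in> radjoint T"
    by (simp add: radjoint_iff zero_prod_def)
next
  fix x y
  assume "x \<in> radjoint T" "y \<in> radjoint T"
  then show "x + y \<in> radjoint T"
    by (cases x; cases y) (simp add: radjoint_iff cinner_simps)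
next
  fix a x
  assume "x \<in> radjoint T"
  then show "a *\<^sub>C x \<in> radjoint T"
    by (cases x) (simp add: radjoint_iff scaleC_prod_def cinner_simps)
qed

lemma radjoint_hclosure: "radjoint (hclosure T) = radjoint T"
proof (intro antisym subsetI; clarify)
  fix k k'
  assume "(k, k') \<in> radjoint (hclosure T)"
  then show "(k, k') \<in> radjoint T"
    using hclosure_superset[of T] unfolding radjoint_iff by blast
next
  fix k k'
  assume k: "(k, k') \<in> radjoint T"
  show "(k, k') \<in> radjoint (hclosure T)"
    unfolding radjoint_iff
  proof (intro allI impI)
    fix f f'
    assume "(f, f') \<in> hclosure T"
    then obtain X where X: "\<And>n. X n \<in> T" "cconv X (f, f')"
      using hclosureE by blast
    have "cinner (snd (X n)) k = cinner (fst (X n)) k'" for n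
      using k X(1)[of n] by (metis prod.collapse radjoint_iff)
    then show "cinner f' k = cinner f k'"
      using LIMSEQ_unique[OF tendsto_cinner_left[OF cconv_fst[OF X(2)], of k']]
        tendsto_cinner_left[OF cconv_snd[OF X(2)], of k] by simp
  qed
qed

lemma symmetric_real_diagonal:
  assumes "symmetric_rel T" "(x, x') \<in> T"
  shows "Im (cinner x' x) = 0"
proof -
  have "cinner x' x = cnj (cinner x' x)"
    using assms unfolding symmetric_rel_def
    by (metis cinner_commute radjoint_iff subsetD)
  then show ?thesis
    by (simp add: complex_eq_iff)
qed

text \<open>In the next two lemmas \<open>Z\<close> plays the role of a spectral parameter; a non-scalar \<open>Z\<close> is needed
  for the two components of the main transform of a boundary triple.\<close>

lemma dissipation_bound:
  assumes real: "Im (cinner x' x) = 0" and Z: "c * (cnorm x)\<^sup>2 \<le> \<bar>Im (cinner (Z x) x)\<bar>"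
  shows "c * cnorm x \<le> cnorm (x' - Z x)"
proof (cases "x = 0")
  case False
  have "c * (cnorm x)\<^sup>2 \<le> \<bar>Im (cinner (x' - Z x) x)\<bar>"
    using real Z by (simp add: cinner_simps)
  also have "\<dots> \<le> cnorm (x' - Z x) * cnorm x"
    using abs_Im_le_cmod Cauchy_Schwarz_cinner order_trans by blast
  finally have "(c * cnorm x) * cnorm x \<le> cnorm (x' - Z x) * cnorm x"
    by (simp add: power2_eq_square mult.assoc)
  moreover have "cnorm x > 0"
    using False cnorm_nonneg[of x] cnorm_eq_zero_iff[of x] by linarith
  ultimately show ?thesis
    by (rule mult_right_le_imp_le)
qed simp

lemma hclosure_range_UNIV:
  fixes T :: "('a::complex_hilbert \<times> 'a) set"
  assumes T: "csubspace T" and real: "\<And>x x'. (x, x') \<in> T \<Longrightarrow> Im (cinner x' x) = 0"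
    and Z_add: "\<And>x y. Z (x + y) = Z x + Z y" and Z_scaleC: "\<And>a x. Z (a *\<^sub>C x) = a *\<^sub>C Z x"
    and Z_bounded: "\<And>x. cnorm (Z x) \<le> b * cnorm x"
    and c: "c > 0" "\<And>x. c * (cnorm x)\<^sup>2 \<le> \<bar>Im (cinner (Z x) x)\<bar>"
    and orth: "\<And>v. (\<And>x x'. (x, x') \<in> T \<Longrightarrow> cinner (x' - Z x) v = 0) \<Longrightarrow> cinner y v = 0"
  shows "\<exists>x x'. (x, x') \<in> hclosure T \<and> x' - Z x = y"
proof -
  have Z_diff: "Z (x - y) = Z x - Z y" for x y
    using Z_add[of x "(-1) *\<^sub>C y"] Z_scaleC[of "-1" y] by (simp add: scaleC_minus_left scaleC_one)
  define R where "R = {x' - Z x |x x'. (x, x') \<in> T}"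
  have "csubspace R"
    unfolding csubspace_def
  proof (intro conjI ballI allI)
    have "(0, 0) \<in> T"
      using csubspace_0[OF T] by (simp add: zero_prod_def)
    moreover have "Z 0 = 0"
      using Z_scaleC[of 0 0] by simp
    ultimately show "0 \<in> R"
      unfolding R_def by (metis (mono_tags, lifting) diff_zero mem_Collect_eq)
  next
    fix u v
    assume "u \<in> R" "v \<in> R"
    then obtain x x' w w' where u: "u = x' - Z x" "(x, x') \<in> T" and v: "v = w' - Z w" "(w, w') \<in> T"
      unfolding R_def by blast
    have "(x + w, x' + w') \<in> T"
      using csubspace_add[OF T u(2) v(2)] by simp
    moreover have "u + v = (x' + w') - Z (x + w)"
      by (simp add: u v Z_add)
    ultimately show "u + v \<in> R"
      unfolding R_def by blast
  next
    fix a u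
    assume "u \<in> R"
    then obtain x x' where u: "u = x' - Z x" "(x, x') \<in> T"
      unfolding R_def by blast
    have "(a *\<^sub>C x, a *\<^sub>C x') \<in> T"
      using csubspace_scaleC[OF T u(2), of a] by (simp add: scaleC_prod_def)
    moreover have "a *\<^sub>C u = a *\<^sub>C x' - Z (a *\<^sub>C x)"
      by (simp add: u Z_scaleC scaleC_simps)
    ultimately show "a *\<^sub>C u \<in> R"
      unfolding R_def by blast
  qed
  then have "y \<in> hclosure R"
    by (rule mem_hclosure_if_biorthogonal) (use orth R_def in blast)
  then obtain Y where Y: "\<And>n. Y n \<in> R" "cconv Y y"
    using hclosureE by blast
  then obtain X X' where X: "\<And>n. (X n, X' n) \<in> T" "\<And>n. Y n = X' n - Z (X n)"
    unfolding R_def by simp metis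
  \<comment> \<open>The dissipation bound gives \<open>x' - Z x\<close> a bounded inverse on T.
    Convergence of the images Y thus gives convergence of X, and then of X' = Y + Z X because Z is
    bounded.\<close>
  have "c * cnorm (X m - X n) \<le> cnorm (Y m - Y n)" for m n
  proof -
    have "(X m - X n, X' m - X' n) \<in> T"
      using csubspace_diff[OF T X(1) X(1)] by simp
    moreover have "Y m - Y n = (X' m - X' n) - Z (X m - X n)"
      by (simp add: X Z_diff)
    ultimately show ?thesis
      using dissipation_bound[of "X' m - X' n" "X m - X n" c Z, OF real c(2)] by simp
  qed
  then obtain x where x: "cconv X x"
    using ccauchy_convergent ccauchy_bounded_by[OF cconv_imp_ccauchy[OF Y(2)] c(1)] by blast
  have "cconv (\<lambda>n. Z (X n)) (Z x)"
    by (rule cconv_lipschitz[OF x]) (use Z_bounded in \<open>simp flip: Z_diff\<close>)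
  then have "cconv (\<lambda>n. Y n + Z (X n)) (y + Z x)"
    using Y(2) by (intro cconv_add)
  then have "cconv (\<lambda>n. (X n, X' n)) (x, y + Z x)"
    using x by (intro cconv_Pair) (simp_all add: X)
  then have "(x, y + Z x) \<in> hclosure T"
    using X(1) by (intro hclosureI[where X = "\<lambda>n. (X n, X' n)"])
  then show ?thesis
    by force
qed

lemma scalar_dissipation: "\<bar>Im z\<bar> * (cnorm x)\<^sup>2 \<le> \<bar>Im (cinner (z *\<^sub>C x) x)\<bar>"
  by (simp add: cinner_simps cinner_self abs_mult del: of_real_power)

text \<open>The scalar case Z = z, where the constant of the lower bound is |Im z|: a dense range of
  T - z becomes the whole space once T is closed.\<close>

lemma symmetric_hclosure_range:
  fixes T :: "('a::complex_hilbert \<times> 'a) set"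
  assumes T: "csubspace T" "symmetric_rel T" and z: "Im z \<noteq> 0"
    and dense: "\<And>v. (\<And>x x'. (x, x') \<in> T \<Longrightarrow> cinner (x' - z *\<^sub>C x) v = 0) \<Longrightarrow> v = 0"
  shows "\<exists>x x'. (x, x') \<in> hclosure T \<and> x' - z *\<^sub>C x = y"
proof (rule hclosure_range_UNIV[where Z = "scaleC z" and b = "cmod z" and c = "\<bar>Im z\<bar>", OF T(1)])
  show "cinner y v = 0" if "\<And>x x'. (x, x') \<in> T \<Longrightarrow> cinner (x' - z *\<^sub>C x) v = 0" for v
    using dense[OF that] by simp
qed (use symmetric_real_diagonal[OF T(2)] z scalar_dissipation in
    \<open>auto simp: scaleC_simps cnorm_scaleC mult.commute\<close>)

text \<open>The identity between the orthogonal complement of ran (T - z) and ker (T* - cnj z). The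
  kernel is written through pairs, so that it makes sense for relations.\<close>

lemma orth_range_iff_radjoint:
  "(\<forall>x x'. (x, x') \<in> T \<longrightarrow> cinner (x' - z *\<^sub>C x) v = 0) \<longleftrightarrow> (v, cnj z *\<^sub>C v) \<in> radjoint T"
  by (auto simp: radjoint_iff cinner_simps)

text \<open>Von Neumann's criterion. A selfadjoint closure has no nonreal eigenvalues. Conversely,
  one deficiency condition makes closure(T) - z surjective, so an element of T* can be reduced by an
  element of closure(T) to an element of ker (T* - z), and the other condition says that this kernel
  is zero.\<close>

lemma ess_selfadjoint_iff_dense_ranges:
  fixes T :: "('a::complex_hilbert \<times> 'a) set"
  assumes T: "csubspace T" "symmetric_rel T" and z: "Im z \<noteq> 0"
  shows "ess_selfadjoint T \<longleftrightarrow>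
    (\<forall>v. (v, z *\<^sub>C v) \<in> radjoint T \<longrightarrow> v = 0) \<and> (\<forall>v. (v, cnj z *\<^sub>C v) \<in> radjoint T \<longrightarrow> v = 0)"
    (is "_ \<longleftrightarrow> ?dense")
proof
  assume "ess_selfadjoint T"
  then have cl: "hclosure T = radjoint T" "symmetric_rel (radjoint T)"
    by (simp_all add: ess_selfadjoint_def symmetric_rel_def) (metis order_refl radjoint_hclosure)
  have "v = 0" if "Im w \<noteq> 0" "(v, w *\<^sub>C v) \<in> radjoint T" for v w
    using symmetric_real_diagonal[OF cl(2) that(2)] that(1)
    by (simp add: cinner_simps cinner_self del: of_real_power)
  then show ?dense
    using z by (metis cnj.simps(2) neg_equal_0_iff_equal)
next
  assume d: ?dense
  have "radjoint T \<subseteq> hclosure T"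
  proof clarify
    fix k k'
    assume k: "(k, k') \<in> radjoint T"
    have "\<exists>x x'. (x, x') \<in> hclosure T \<and> x' - z *\<^sub>C x = k' - z *\<^sub>C k"
      using d by (intro symmetric_hclosure_range T z) (meson orth_range_iff_radjoint)
    then obtain x x' where x: "(x, x') \<in> hclosure T" "x' - z *\<^sub>C x = k' - z *\<^sub>C k"
      by blast
    have "hclosure T \<subseteq> radjoint T"
      using T(2) hclosed_radjoint[of T] unfolding symmetric_rel_def hclosure_def by blast
    then have "(k - x, k' - x') \<in> radjoint T"
      using csubspace_diff[OF csubspace_radjoint k] x(1) by fastforce
    moreover have "k' - x' = z *\<^sub>C (k - x)"
      using x(2) by (simp add: scaleC_simps algebra_simps)
    ultimately have "k = x"
      using d by (metis eq_iff_diff_eq_0)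
    then show "(k, k') \<in> hclosure T"
      using x by simp
  qed
  moreover have "hclosure T \<subseteq> radjoint T"
    using T(2) hclosed_radjoint[of T] unfolding symmetric_rel_def hclosure_def by blast
  ultimately show "ess_selfadjoint T"
    by (auto simp: ess_selfadjoint_def)
qed

section \<open>Closability of operators and of forms\<close>

lemma rclosable_iff:
  assumes "csubspace T"
  shows "rclosable T \<longleftrightarrow> (\<forall>g. (0, g) \<in> hclosure T \<longrightarrow> g = 0)"
proof -
  have "(0, 0) \<in> hclosure T"
    using csubspace_0[OF assms] hclosure_superset[of T] by (auto simp: zero_prod_def)
  then show ?thesis
    by (auto simp: rclosable_def rmul_def)
qed

text \<open>The setting of this and the next two lemmas is a form with t[u,u] = |f|^2 for every (u,
  f) in T. It translates form convergence into convergence of images under T, and is applied with T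
  = \<open>\<gamma> z\<close> and the form of the Weyl function.\<close>

lemma form_cauchy_iff:
  assumes T: "csubspace T" and norm: "\<And>u f. (u, f) \<in> T \<Longrightarrow> snd t u u = of_real ((cnorm f)\<^sup>2)"
    and X: "\<And>n. (X n, Y n) \<in> T"
  shows "form_cauchy t X \<longleftrightarrow> ccauchy Y"
proof -
  have eq: "cmod (snd t (X n - X m) (X n - X m)) = (cnorm (Y n - Y m))\<^sup>2" for m n
    using norm[of "X n - X m" "Y n - Y m"] csubspace_diff[OF T X X, of n m]
    by (simp del: of_real_power)
  show ?thesis
    unfolding form_cauchy_def ccauchy_def eq
  proof (intro iffI allI impI)
    fix e :: real
    assume e: "e > 0" and "\<forall>e>0. \<exists>N. \<forall>m\<ge>N. \<forall>n\<ge>N. (cnorm (Y n - Y m))\<^sup>2 < e"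
    then obtain N where "\<And>m n. m \<ge> N \<Longrightarrow> n \<ge> N \<Longrightarrow> (cnorm (Y n - Y m))\<^sup>2 < e\<^sup>2"
      by (meson zero_less_power)
    then show "\<exists>N. \<forall>m\<ge>N. \<forall>n\<ge>N. cnorm (Y m - Y n) < e"
      using e by (meson less_imp_le power2_less_imp_less)
  next
    fix e :: real
    assume e: "e > 0" and "\<forall>e>0. \<exists>N. \<forall>m\<ge>N. \<forall>n\<ge>N. cnorm (Y m - Y n) < e"
    then obtain N where N: "\<And>m n. m \<ge> N \<Longrightarrow> n \<ge> N \<Longrightarrow> cnorm (Y m - Y n) < sqrt e"
      by (meson real_sqrt_gt_zero)
    have "(cnorm (Y n - Y m))\<^sup>2 < e" if "m \<ge> N" "n \<ge> N" for m n
      using power_strict_mono[OF N[OF that(2,1)], of 2] e by simp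
    then show "\<exists>N. \<forall>m\<ge>N. \<forall>n\<ge>N. (cnorm (Y n - Y m))\<^sup>2 < e"
      by blast
  qed
qed

text \<open>If (0, g) is a limit of pairs in T, then the first components are form Cauchy and their
  form values tend to |g|^2. Conversely, completeness of the target space supplies a limit g for the
  images of a form Cauchy null sequence, and (0, g) lies in the closure of T.\<close>

lemma form_closable_iff:
  fixes T :: "('a::complex_inner \<times> 'b::complex_hilbert) set"
  assumes T: "csubspace T" and norm: "\<And>u f. (u, f) \<in> T \<Longrightarrow> snd t u u = of_real ((cnorm f)\<^sup>2)"
    and dom: "fst t = Domain T"
  shows "form_closable t \<longleftrightarrow> rclosable T"
  unfolding rclosable_iff[OF T]
proof (intro iffI allI impI)
  fix g
  assume cl: "form_closable t" and "(0, g) \<in> hclosure T"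
  then obtain P where P: "\<And>n. P n \<in> T" "cconv P (0, g)"
    using hclosureE by blast
  define X Y where "X n = fst (P n)" and "Y n = snd (P n)" for n
  have XT: "(X n, Y n) \<in> T" for n
    using P(1) by (simp add: X_def Y_def)
  have lim: "cconv X 0" "cconv Y g"
    using cconv_fst[OF P(2)] cconv_snd[OF P(2)] by (simp_all add: X_def[abs_def] Y_def[abs_def])
  have "form_cauchy t X"
    using form_cauchy_iff[of T t X Y] T norm XT cconv_imp_ccauchy[OF lim(2)] by blast
  then have "(\<lambda>n. snd t (X n) (X n)) \<longlonglongrightarrow> 0"
    using cl lim(1) XT unfolding form_closable_def dom by blast
  then have "(\<lambda>n. (cnorm (Y n))\<^sup>2) \<longlonglongrightarrow> 0"
    unfolding norm[OF XT] by (simp add: tendsto_of_real_iff[of _ 0, simplified] del: of_real_power)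
  then have "cnorm g = 0"
    using LIMSEQ_unique[OF tendsto_power[OF tendsto_cnorm[OF lim(2)], of 2]] by fastforce
  then show "g = 0"
    by simp
next
  assume cl: "\<forall>g. (0, g) \<in> hclosure T \<longrightarrow> g = 0"
  show "form_closable t"
    unfolding form_closable_def dom
  proof (intro allI impI, elim conjE)
    fix X
    assume X: "\<forall>n. X n \<in> Domain T" "cconv X 0" "form_cauchy t X"
    then obtain Y where Y: "\<And>n. (X n, Y n) \<in> T"
      by (auto simp: Domain_iff) metis
    then have "ccauchy Y"
      using form_cauchy_iff[of T t X Y] T norm X(3) by blast
    then obtain g where g: "cconv Y g"
      using ccauchy_convergent by blast
    have "(0, g) \<in> hclosure T"
      using cconv_Pair[OF X(2) g] Y by (intro hclosureI[where X = "\<lambda>n. (X n, Y n)"])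
    then have "cconv Y 0"
      using cl g by blast
    then have "(\<lambda>n. (cnorm (Y n))\<^sup>2) \<longlonglongrightarrow> 0\<^sup>2"
      using tendsto_power[OF tendsto_cnorm, of Y 0 2] by simp
    then show "(\<lambda>n. snd t (X n) (X n)) \<longlonglongrightarrow> 0"
      unfolding norm[OF Y] using tendsto_of_real by fastforce
  qed
qed

lemma form_closure_dom_eq:
  fixes T :: "('a::complex_inner \<times> 'b::complex_hilbert) set"
  assumes T: "csubspace T" and norm: "\<And>u f. (u, f) \<in> T \<Longrightarrow> snd t u u = of_real ((cnorm f)\<^sup>2)"
    and dom: "fst t = Domain T"
  shows "form_closure_dom t = Domain (hclosure T)"
proof (intro antisym subsetI)
  fix u
  assume "u \<in> form_closure_dom t"
  then obtain X where X: "\<forall>n. X n \<in> Domain T" "cconv X u" "form_cauchy t X"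
    unfolding form_closure_dom_def dom by blast
  then obtain Y where Y: "\<And>n. (X n, Y n) \<in> T"
    by (auto simp: Domain_iff) metis
  then have "ccauchy Y"
    using form_cauchy_iff[of T t X Y] T norm X(3) by blast
  then obtain g where g: "cconv Y g"
    using ccauchy_convergent by blast
  have "(u, g) \<in> hclosure T"
    using cconv_Pair[OF X(2) g] Y by (intro hclosureI[where X = "\<lambda>n. (X n, Y n)"])
  then show "u \<in> Domain (hclosure T)"
    by blast
next
  fix u
  assume "u \<in> Domain (hclosure T)"
  then obtain g P where P: "\<And>n. P n \<in> T" "cconv P (u, g)"
    using hclosureE by blast
  define X Y where "X n = fst (P n)" and "Y n = snd (P n)" for n
  have XT: "(X n, Y n) \<in> T" for n
    using P(1) by (simp add: X_def Y_def)
  have lim: "cconv X u" "cconv Y g"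
    using cconv_fst[OF P(2)] cconv_snd[OF P(2)] by (simp_all add: X_def[abs_def] Y_def[abs_def])
  have "form_cauchy t X"
    using form_cauchy_iff[of T t X Y] T norm XT cconv_imp_ccauchy[OF lim(2)] by blast
  then show "u \<in> form_closure_dom t"
    using lim(1) XT unfolding form_closure_dom_def dom by blast
qed

text \<open>The orthogonal complement of T consists of the pairs (-k', k) with (k, k') in T*. If v
  is orthogonal to dom T*, then (0, v) is orthogonal to all of these, hence lies in the closure of
  T, and closability gives v = 0.\<close>

lemma closable_imp_radjoint_Domain_dense:
  fixes T :: "('a::complex_hilbert \<times> 'b::complex_hilbert) set"
  assumes T: "csubspace T" "rclosable T"
    and v: "\<And>y. y \<in> Domain (radjoint T) \<Longrightarrow> cinner y v = 0"
  shows "v = 0"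
proof -
  have "(0, v) \<in> hclosure T"
  proof (rule mem_hclosure_if_biorthogonal[OF T(1)])
    fix w
    assume w: "\<And>s. s \<in> T \<Longrightarrow> cinner s w = 0"
    have "(snd w, - fst w) \<in> radjoint T"
      unfolding radjoint_iff
    proof (intro allI impI)
      fix f f'
      assume "(f, f') \<in> T"
      then have "cinner f (fst w) + cinner f' (snd w) = 0"
        using w by (fastforce simp: cinner_prod_def)
      then show "cinner f' (snd w) = cinner f (- fst w)"
        by (simp add: cinner_simps add_eq_0_iff)
    qed
    then have "cinner (snd w) v = 0"
      using v by blast
    then show "cinner (0, v) w = 0"
      using cinner_commute[of v "snd w"] by (simp add: cinner_prod_def)
  qed
  then show ?thesis
    using T by (simp add: rclosable_iff)
qed

section \<open>Unitary boundary triples\<close>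

text \<open>\<mu> is the companion of z in the boundary space. Taking it purely imaginary lets
  -\<mu> be the companion of cnj z, as duality arguments require.\<close>

lemma ex_same_sign: "Im z \<noteq> 0 \<Longrightarrow> \<exists>\<mu>. \<mu> \<noteq> 0 \<and> cnj \<mu> = - \<mu> \<and> Im z * Im \<mu> > 0"
  by (rule exI[of _ "\<i> * of_real (Im z)"]) (auto simp: complex_eq_iff zero_less_mult_iff)

locale unitary_triple =
  fixes Dom :: "('h::complex_hilbert \<times> 'h) set" and G0 G1 :: "'h \<times> 'h \<Rightarrow> 'k::complex_hilbert"
  assumes unitary: "unitary_bt Dom G0 G1"
begin

abbreviation "M \<equiv> weyl_rel Dom G0 G1"
abbreviation "\<gamma> \<equiv> gamma_rel Dom G0"
abbreviation "A0 \<equiv> A0_rel Dom G0"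

lemma green:
  assumes "f \<in> Dom" "g \<in> Dom"
  shows "cinner (snd f) (fst g) - cinner (fst f) (snd g) = cinner (G1 f) (G0 g) - cinner (G0 f) (G1 g)"
  using unitary assms unfolding unitary_bt_def isometric_bt_def by blast

lemma Dom_csubspace: "csubspace Dom"
  using unitary unfolding unitary_bt_def isometric_bt_def linear_on_def by blast

lemma G_add:
  assumes "f \<in> Dom" "g \<in> Dom"
  shows "G0 (f + g) = G0 f + G0 g" "G1 (f + g) = G1 f + G1 g"
  using unitary assms unfolding unitary_bt_def isometric_bt_def linear_on_def by blast+

lemma G_scaleC:
  assumes "f \<in> Dom"
  shows "G0 (a *\<^sub>C f) = a *\<^sub>C G0 f" "G1 (a *\<^sub>C f) = a *\<^sub>C G1 f"
  using unitary assms unfolding unitary_bt_def isometric_bt_def linear_on_def by blast+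

lemma G_diff:
  assumes "f \<in> Dom" "g \<in> Dom"
  shows "G0 (f - g) = G0 f - G0 g" "G1 (f - g) = G1 f - G1 g"
  using G_add[OF assms(1) csubspace_scaleC[OF Dom_csubspace assms(2)], of "-1"] G_scaleC[OF assms(2), of "-1"]
  by (simp_all add: scaleC_minus_left scaleC_one)

lemma G_zero: "G0 0 = 0" "G1 0 = 0"
  using G_scaleC[OF csubspace_0[OF Dom_csubspace], of 0] by simp_all

text \<open>The inclusion of \<open>krein_adjoint\<close> in the converse of the graph, read
  elementwise. The opposite inclusion is the Green identity.\<close>

lemma maximality:
  assumes "\<And>f. f \<in> Dom \<Longrightarrow>
    cinner (snd f) g - cinner (fst f) g' = cinner (G1 f) k - cinner (G0 f) k'"
  shows "(g, g') \<in> Dom \<and> G0 (g, g') = k \<and> G1 (g, g') = k'"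
proof -
  have "((k, k'), (g, g')) \<in> krein_adjoint (Gamma_graph Dom G0 G1)"
    using assms unfolding krein_adjoint_def Gamma_graph_def by auto
  then have "((g, g'), (k, k')) \<in> Gamma_graph Dom G0 G1"
    using unitary unfolding unitary_bt_def by (metis converse_iff)
  then show ?thesis
    by (auto simp: Gamma_graph_def)
qed

text \<open>The graph of \<open>\<Gamma>\<close>, rearranged so that the Green identity and unitarity of \<open>\<Gamma>\<close> say that the
  resulting relation in \<open>\<HH> \<times> \<H>\<close> is selfadjoint.\<close>

definition main_transform :: "(('h \<times> 'k) \<times> ('h \<times> 'k)) set" where
  "main_transform = {((fst f, G0 f), (snd f, - G1 f)) |f. f \<in> Dom}"

lemma main_transform_selfadjoint: "radjoint main_transform = main_transform"
proof (intro antisym subsetI; clarify)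
  fix g k g' k'
  assume *: "((g, k), (g', k')) \<in> radjoint main_transform"
  have "cinner (snd f) g - cinner (fst f) g' = cinner (G1 f) k - cinner (G0 f) (- k')"
    if "f \<in> Dom" for f
  proof -
    have "((fst f, G0 f), (snd f, - G1 f)) \<in> main_transform"
      using that unfolding main_transform_def by blast
    then have "cinner (snd f, - G1 f) (g, k) = cinner (fst f, G0 f) (g', k')"
      using * unfolding radjoint_iff by blast
    then show ?thesis
      by (simp add: cinner_prod_def cinner_simps algebra_simps)
  qed
  from maximality[OF this] show "((g, k), (g', k')) \<in> main_transform"
    unfolding main_transform_def by force
next
  fix g k g' k'
  assume "((g, k), (g', k')) \<in> main_transform"
  then obtain h where h: "h \<in> Dom" "g = fst h" "k = G0 h" "g' = snd h" "k' = - G1 h"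
    unfolding main_transform_def by blast
  show "((g, k), (g', k')) \<in> radjoint main_transform"
    unfolding radjoint_iff
  proof (intro allI impI)
    fix x x'
    assume "(x, x') \<in> main_transform"
    then obtain f where "f \<in> Dom" "x = (fst f, G0 f)" "x' = (snd f, - G1 f)"
      unfolding main_transform_def by blast
    then show "cinner x' (g, k) = cinner x (g', k')"
      using green[of f h] h by (simp add: cinner_prod_def cinner_simps algebra_simps)
  qed
qed

lemma main_transform_symmetric: "symmetric_rel main_transform"
  by (simp add: symmetric_rel_def main_transform_selfadjoint)

lemma main_transform_csubspace: "csubspace main_transform"
  using csubspace_radjoint[of main_transform] by (simp add: main_transform_selfadjoint)

section \<open>The boundary problem f' - z f = a, G1 f + \<mu> G0 f = b\<close>

lemma diagonal_dissipation:
  fixes x :: "'h \<times> 'k"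
  assumes "Im z * Im \<mu> > 0"
  shows "min \<bar>Im z\<bar> \<bar>Im \<mu>\<bar> * (cnorm x)\<^sup>2 \<le> \<bar>Im (cinner (z *\<^sub>C fst x, \<mu> *\<^sub>C snd x) x)\<bar>"
proof -
  have "\<bar>Im (cinner (z *\<^sub>C fst x, \<mu> *\<^sub>C snd x) x)\<bar> = \<bar>Im z * (cnorm (fst x))\<^sup>2 + Im \<mu> * (cnorm (snd x))\<^sup>2\<bar>"
    by (simp add: cinner_prod_def cinner_simps cinner_self del: of_real_power)
  \<comment> \<open>Im z and Im \<mu> have the same sign, so the two terms cannot cancel.\<close>
  also have "\<dots> = \<bar>Im z\<bar> * (cnorm (fst x))\<^sup>2 + \<bar>Im \<mu>\<bar> * (cnorm (snd x))\<^sup>2"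
    using assms by (auto simp: zero_less_mult_iff abs_of_nonneg abs_of_nonpos add_nonpos_nonpos mult_nonpos_nonneg)
  also have "\<dots> \<ge> min \<bar>Im z\<bar> \<bar>Im \<mu>\<bar> * (cnorm (fst x))\<^sup>2 + min \<bar>Im z\<bar> \<bar>Im \<mu>\<bar> * (cnorm (snd x))\<^sup>2"
    by (intro add_mono mult_right_mono) simp_all
  finally show ?thesis
    by (simp only: cnorm_prod_power2[of x] distrib_left)
qed

text \<open>The dissipation bound for the main transform minus diag(z, \<mu>), which sends (f, G0 f)
  to (f' - z f, -(G1 f + \<mu> G0 f)). Each component of (f, G0 f) is at most the norm of the
  pair.\<close>

lemma boundary_problem_bound:
  assumes z: "Im z * Im \<mu> > 0" and f: "f \<in> Dom"
  defines "c \<equiv> min \<bar>Im z\<bar> \<bar>Im \<mu>\<bar>"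
  shows "c * cnorm (fst f) \<le> cnorm (snd f - z *\<^sub>C fst f) + cnorm (G1 f + \<mu> *\<^sub>C G0 f)"
    and "c * cnorm (G0 f) \<le> cnorm (snd f - z *\<^sub>C fst f) + cnorm (G1 f + \<mu> *\<^sub>C G0 f)"
proof -
  have "((fst f, G0 f), (snd f, - G1 f)) \<in> main_transform"
    using f unfolding main_transform_def by blast
  then have "c * cnorm (fst f, G0 f)
      \<le> cnorm ((snd f, - G1 f) - (z *\<^sub>C fst (fst f, G0 f), \<mu> *\<^sub>C snd (fst f, G0 f)))"
    unfolding c_def by (intro dissipation_bound[where Z = "\<lambda>x. (z *\<^sub>C fst x, \<mu> *\<^sub>C snd x)"]
        symmetric_real_diagonal[OF main_transform_symmetric] diagonal_dissipation z)
  also have "\<dots> \<le> cnorm (snd f - z *\<^sub>C fst f) + cnorm (G1 f + \<mu> *\<^sub>C G0 f)"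
    using cnorm_prod_le[of "(snd f - z *\<^sub>C fst f, - G1 f - \<mu> *\<^sub>C G0 f)"]
      cnorm_minus[of "G1 f + \<mu> *\<^sub>C G0 f"] by simp
  finally have *: "c * cnorm (fst f, G0 f) \<le> \<dots>" .
  have "c \<ge> 0"
    by (simp add: c_def)
  then have "c * cnorm (fst f) \<le> c * cnorm (fst f, G0 f)" "c * cnorm (G0 f) \<le> c * cnorm (fst f, G0 f)"
    using cnorm_fst_le[of "(fst f, G0 f)"] cnorm_snd_le[of "(fst f, G0 f)"]
    by (simp_all add: mult_left_mono)
  with * show "c * cnorm (fst f) \<le> cnorm (snd f - z *\<^sub>C fst f) + cnorm (G1 f + \<mu> *\<^sub>C G0 f)"
    and "c * cnorm (G0 f) \<le> cnorm (snd f - z *\<^sub>C fst f) + cnorm (G1 f + \<mu> *\<^sub>C G0 f)"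
    by linarith+
qed

text \<open>The main transform is selfadjoint, hence closed, so it remains to see that subtracting Z
  = diag(z, \<mu>) leaves a dense range. A vector v orthogonal to that range makes (v, Z* v) an
  element of the main transform. Then (Z* v, v) is real, whereas Z* is again definite in its
  imaginary part, so v = 0.\<close>

lemma boundary_problem_solvable:
  assumes z: "Im z * Im \<mu> > 0"
  obtains f where "f \<in> Dom" "snd f - z *\<^sub>C fst f = a" "G1 f + \<mu> *\<^sub>C G0 f = b"
proof -
  define Z :: "'h \<times> 'k \<Rightarrow> 'h \<times> 'k" where "Z x = (z *\<^sub>C fst x, \<mu> *\<^sub>C snd x)" for x
  have "\<exists>x x'. (x, x') \<in> hclosure main_transform \<and> x' - Z x = (a, - b)"
  proof (rule hclosure_range_UNIV[where b = "cmod z + cmod \<mu>" and c = "min \<bar>Im z\<bar> \<bar>Im \<mu>\<bar>"])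
    show "csubspace main_transform"
      by (rule main_transform_csubspace)
    show "Im (cinner x' x) = 0" if "(x, x') \<in> main_transform" for x x'
      using symmetric_real_diagonal[OF main_transform_symmetric that] .
    show "Z (x + y) = Z x + Z y" "Z (e *\<^sub>C x) = e *\<^sub>C Z x" for x y e
      by (simp_all add: Z_def scaleC_prod_def scaleC_simps mult.commute)
    show "cnorm (Z x) \<le> (cmod z + cmod \<mu>) * cnorm x" for x
      using cnorm_prod_le[of "Z x"] mult_left_mono[OF cnorm_fst_le[of x], of "cmod z"]
        mult_left_mono[OF cnorm_snd_le[of x], of "cmod \<mu>"]
      by (simp add: Z_def cnorm_scaleC distrib_right)
    show "min \<bar>Im z\<bar> \<bar>Im \<mu>\<bar> > 0"
      using z by (auto simp: zero_less_mult_iff)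
    show "min \<bar>Im z\<bar> \<bar>Im \<mu>\<bar> * (cnorm x)\<^sup>2 \<le> \<bar>Im (cinner (Z x) x)\<bar>" for x
      unfolding Z_def by (rule diagonal_dissipation[OF z])
    fix v
    assume v: "\<And>x x'. (x, x') \<in> main_transform \<Longrightarrow> cinner (x' - Z x) v = 0"
    define v' where "v' = (cnj z *\<^sub>C fst v, cnj \<mu> *\<^sub>C snd v)"
    have "cinner (Z x) v = cinner x v'" for x
      by (simp add: Z_def v'_def cinner_prod_def cinner_simps)
    then have "(v, v') \<in> radjoint main_transform"
      using v by (simp add: radjoint_iff cinner_simps)
    then have "Im (cinner v' v) = 0"
      using symmetric_real_diagonal[OF main_transform_symmetric] by (simp add: main_transform_selfadjoint)
    then have "min \<bar>Im z\<bar> \<bar>Im \<mu>\<bar> * (cnorm v)\<^sup>2 \<le> 0"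
      using diagonal_dissipation[of "cnj z" "cnj \<mu>" v] z by (simp add: v'_def)
    moreover have "min \<bar>Im z\<bar> \<bar>Im \<mu>\<bar> > 0"
      using z by (auto simp: zero_less_mult_iff)
    ultimately have "v = 0"
      by (simp add: mult_le_0_iff)
    then show "cinner (a, - b) v = 0"
      by simp
  qed
  then obtain x x' where x: "(x, x') \<in> main_transform" "x' - Z x = (a, - b)"
    using hclosed_radjoint[of main_transform] by (auto simp: main_transform_selfadjoint)
  then obtain f where f: "f \<in> Dom" "x = (fst f, G0 f)" "x' = (snd f, - G1 f)"
    unfolding main_transform_def by blast
  then have "snd f - z *\<^sub>C fst f = a" "- (G1 f + \<mu> *\<^sub>C G0 f) = - b"
    using x(2) by (simp_all add: Z_def)
  then show ?thesis
    using that f(1) by (metis neg_equal_iff_equal)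
qed

section \<open>Defect elements, the Weyl function and its form\<close>

lemma weylI: "f \<in> defect_hat Dom z \<Longrightarrow> (G0 f, G1 f) \<in> M z"
  and gammaI: "f \<in> defect_hat Dom z \<Longrightarrow> (G0 f, fst f) \<in> \<gamma> z"
  unfolding weyl_rel_def gamma_rel_def by blast+

lemma defect_hat_iff: "f \<in> defect_hat Dom z \<longleftrightarrow> f \<in> Dom \<and> snd f - z *\<^sub>C fst f = 0"
  by (auto simp: defect_hat_def)

lemma defect_hatD: "f \<in> defect_hat Dom z \<Longrightarrow> f \<in> Dom"
  "f \<in> defect_hat Dom z \<Longrightarrow> snd f = z *\<^sub>C fst f"
  by (auto simp: defect_hat_def)

lemma defect_hat_csubspace: "csubspace (defect_hat Dom z)"
  using Dom_csubspace unfolding csubspace_def defect_hat_def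
  by (auto simp: scaleC_Pair fst_scaleC snd_scaleC scaleC_simps mult.commute)

lemma weyl_csubspace: "csubspace (M z)"
proof -
  have "M z = (\<lambda>f. (G0 f, G1 f)) ` defect_hat Dom z"
    unfolding weyl_rel_def by blast
  also have "csubspace \<dots>"
    by (rule csubspace_linear_image[OF defect_hat_csubspace])
      (simp_all add: G_add G_scaleC defect_hatD(1) scaleC_Pair fst_scaleC)
  finally show ?thesis .
qed

lemma gamma_csubspace: "csubspace (\<gamma> z)"
proof -
  have "\<gamma> z = (\<lambda>f. (G0 f, fst f)) ` defect_hat Dom z"
    unfolding gamma_rel_def by blast
  also have "csubspace \<dots>"
    by (rule csubspace_linear_image[OF defect_hat_csubspace])
      (simp_all add: G_add G_scaleC defect_hatD(1) scaleC_Pair fst_scaleC)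
  finally show ?thesis .
qed

lemma A0_csubspace: "csubspace A0"
  using Dom_csubspace unfolding csubspace_def A0_rel_def
  by (auto simp: G_add G_scaleC G_zero)

lemma A0_symmetric: "symmetric_rel A0"
  unfolding symmetric_rel_def
proof clarify
  fix k k'
  assume k: "(k, k') \<in> A0"
  show "(k, k') \<in> radjoint A0"
    unfolding radjoint_iff
  proof (intro allI impI)
    fix f f'
    assume "(f, f') \<in> A0"
    then show "cinner f' k = cinner f k'"
      using green[of "(f, f')" "(k, k')"] k by (simp add: A0_rel_def)
  qed
qed

text \<open>A nonzero such f would give the symmetric relation \<open>A0\<close> a nonreal
  eigenvalue. This is what makes \<open>M z\<close> single-valued.\<close>

lemma defect_hat_eq_0:
  assumes "Im z \<noteq> 0" "f \<in> defect_hat Dom z" "G0 f = 0"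
  shows "f = 0"
proof -
  have "(fst f, snd f) \<in> A0"
    using assms by (simp add: A0_rel_def defect_hatD(1))
  from symmetric_real_diagonal[OF A0_symmetric this] have "fst f = 0"
    using assms(1) defect_hatD(2)[OF assms(2)]
    by (simp add: cinner_simps cinner_self del: of_real_power)
  then show ?thesis
    using defect_hatD(2)[OF assms(2)] by (simp add: prod_eq_iff)
qed

lemma weyl_is_operator:
  assumes "Im z \<noteq> 0"
  shows "is_operator (M z)"
proof -
  have "G1 f = G1 g" if fg: "f \<in> defect_hat Dom z" "g \<in> defect_hat Dom z" "G0 f = G0 g" for f g
    using defect_hat_eq_0[OF assms csubspace_diff[OF defect_hat_csubspace fg(1,2)]] fg
    by (simp add: G_diff defect_hatD(1))
  then show ?thesis
    unfolding is_operator_def weyl_rel_def by auto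
qed

lemma weyl_green:
  assumes "f \<in> defect_hat Dom z" "g \<in> defect_hat Dom w"
  shows "(z - cnj w) * cinner (fst f) (fst g) = cinner (G1 f) (G0 g) - cinner (G0 f) (G1 g)"
  using green[of f g] assms by (simp add: defect_hatD cinner_simps algebra_simps)

text \<open>With the same defect element in both slots, the Green identity gives (z - cnj z)|f|^2,
  and the factor cancels the denominator of the form.\<close>

lemma form_of_weyl:
  assumes z: "Im z \<noteq> 0" and u: "(u, f) \<in> \<gamma> z"
  shows "snd (form_of (M z) z) u u = of_real ((cnorm f)\<^sup>2)"
proof -
  obtain x where x: "x \<in> defect_hat Dom z" "u = G0 x" "f = fst x"
    using u unfolding gamma_rel_def by blast
  then have "op_app (M z) u = G1 x"
    by (intro op_app_eq weyl_is_operator z) (simp add: weylI)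
  then have "snd (form_of (M z) z) u u = (z - cnj z) * cinner (fst x) (fst x) / (z - cnj z)"
    using weyl_green[OF x(1) x(1)] by (simp add: form_of_def x)
  moreover have "z - cnj z \<noteq> 0"
    using z by (simp add: complex_eq_iff)
  ultimately show ?thesis
    by (simp add: cinner_self x del: of_real_power)
qed

lemma form_of_weyl_dom: "fst (form_of (M z) z) = Domain (\<gamma> z)"
  by (auto simp: form_of_def weyl_rel_def gamma_rel_def)

lemma form_closable_weyl_iff:
  "Im z \<noteq> 0 \<Longrightarrow> form_closable (form_of (M z) z) \<longleftrightarrow> rclosable (\<gamma> z)"
  by (intro form_closable_iff gamma_csubspace form_of_weyl form_of_weyl_dom)

lemma form_closure_dom_weyl:
  "Im z \<noteq> 0 \<Longrightarrow> form_closure_dom (form_of (M z) z) = Domain (hclosure (\<gamma> z))"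
  by (intro form_closure_dom_eq gamma_csubspace form_of_weyl form_of_weyl_dom)

section \<open>Membership of the Weyl function in the class R^s\<close>

lemma weyl_adjoint:
  assumes z: "Im z \<noteq> 0"
  shows "radjoint (M z) = M (cnj z)"
proof (intro antisym subsetI; clarify)
  fix k k'
  assume k: "(k, k') \<in> radjoint (M z)"
  obtain \<mu> where \<mu>: "cnj \<mu> = - \<mu>" "Im z * Im \<mu> > 0"
    using ex_same_sign[OF z] by blast
  \<comment> \<open>Choose a pair (G0 g, G1 g) in \<open>M (cnj z)\<close> with the same value of k'
    - \<mu> k. The difference from (k, k') then has the form (p, \<mu> p).\<close>
  obtain g where g: "g \<in> Dom" "snd g - cnj z *\<^sub>C fst g = 0" "G1 g + (- \<mu>) *\<^sub>C G0 g = k' - \<mu> *\<^sub>C k"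
    by (rule boundary_problem_solvable[of "cnj z" "- \<mu>" 0 "k' - \<mu> *\<^sub>C k"]) (use \<mu> in auto)
  have gd: "g \<in> defect_hat Dom (cnj z)"
    using g by (simp add: defect_hat_iff)
  define p where "p = k - G0 g"
  have p': "k' - G1 g = \<mu> *\<^sub>C p"
    using g(3) by (simp add: p_def scaleC_simps algebra_simps)
  \<comment> \<open>p is orthogonal to ran (M(z) + \<mu>). That range is the whole space by
    solvability of the boundary problem, hence p = 0.\<close>
  have orth: "cinner (G1 f + \<mu> *\<^sub>C G0 f) p = 0" if f: "f \<in> defect_hat Dom z" for f
  proof -
    have "cinner (G1 f) k = cinner (G0 f) k'"
      using k f unfolding radjoint_iff weyl_rel_def by blast
    moreover have "cinner (G1 f) (G0 g) = cinner (G0 f) (G1 g)"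
      using weyl_green[OF f gd] by simp
    ultimately have "cinner (G1 f) p = cinner (G0 f) (\<mu> *\<^sub>C p)"
      unfolding p'[symmetric] by (simp add: p_def cinner_simps)
    then show ?thesis
      by (simp add: cinner_simps \<mu>(1))
  qed
  obtain f where "f \<in> Dom" "snd f - z *\<^sub>C fst f = 0" "G1 f + \<mu> *\<^sub>C G0 f = p"
    using boundary_problem_solvable[OF \<mu>(2), of 0 p] by blast
  then have "p = 0"
    using orth[of f] by (simp add: defect_hat_iff cinner_self_eq_zero)
  then have "k = G0 g" "k' = G1 g"
    using p' by (simp_all add: p_def)
  then show "(k, k') \<in> M (cnj z)"
    using gd unfolding weyl_rel_def by blast
next
  fix k k'
  assume "(k, k') \<in> M (cnj z)"
  then obtain g where g: "g \<in> defect_hat Dom (cnj z)" "k = G0 g" "k' = G1 g"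
    unfolding weyl_rel_def by blast
  show "(k, k') \<in> radjoint (M z)"
    unfolding radjoint_iff
  proof (intro allI impI)
    fix u u'
    assume "(u, u') \<in> M z"
    then obtain f where "f \<in> defect_hat Dom z" "u = G0 f" "u' = G1 f"
      unfolding weyl_rel_def by blast
    then show "cinner u' k = cinner u k'"
      using weyl_green[of f z g "cnj z"] g by simp
  qed
qed

text \<open>\<open>M z\<close> is the adjoint of \<open>M (cnj z)\<close>, and adjoints are
  closed.\<close>

lemma weyl_hclosed:
  assumes "Im z \<noteq> 0"
  shows "hclosed (M z)"
  using hclosed_radjoint[of "M (cnj z)"] weyl_adjoint[of "cnj z"] assms by (simp add: hclosed_def)

lemma weyl_Im:
  assumes "f \<in> defect_hat Dom z"
  shows "Im (cinner (G1 f) (G0 f)) = Im z * (cnorm (fst f))\<^sup>2"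
proof -
  have "(z - cnj z) * of_real ((cnorm (fst f))\<^sup>2) = cinner (G1 f) (G0 f) - cnj (cinner (G1 f) (G0 f))"
    using weyl_green[OF assms assms] by (simp add: cinner_self[of "fst f"] flip: cinner_commute)
  from arg_cong[OF this, of Im] show ?thesis
    by (simp del: of_real_power)
qed

text \<open>Since M(z) + \<i> is onto, an element of a dissipative extension S differs from one of
  \<open>M z\<close> by a pair (p, -\<i> p) in S. Dissipativity gives -|p|^2 \<ge> 0, so p =
  0.\<close>

lemma weyl_max_dissipative:
  assumes z: "Im z > 0"
  shows "max_dissipative (M z)"
  unfolding max_dissipative_def
proof (intro conjI allI impI weyl_csubspace)
  show "dissipative (M z)"
    using z weyl_Im by (auto simp: dissipative_def weyl_rel_def)
  fix S
  assume S: "csubspace S \<and> dissipative S \<and> M z \<subseteq> S"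
  have "(k, k') \<in> M z" if k: "(k, k') \<in> S" for k k'
  proof -
    obtain f where f: "f \<in> Dom" "snd f - z *\<^sub>C fst f = 0" "G1 f + \<i> *\<^sub>C G0 f = k' + \<i> *\<^sub>C k"
      by (rule boundary_problem_solvable[of z \<i> 0 "k' + \<i> *\<^sub>C k"]) (use z in auto)
    then have fM: "(G0 f, G1 f) \<in> M z"
      by (simp add: weylI defect_hat_iff)
    then have "(k - G0 f, k' - G1 f) \<in> S"
      using S csubspace_diff[of S "(k, k')" "(G0 f, G1 f)"] k by auto
    moreover have "k' - G1 f = (- \<i>) *\<^sub>C (k - G0 f)"
      using f(3) by (simp add: scaleC_simps algebra_simps)
    ultimately have "Im (cinner ((- \<i>) *\<^sub>C (k - G0 f)) (k - G0 f)) \<ge> 0"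
      using S unfolding dissipative_def by fastforce
    then have "k = G0 f"
      by (simp add: cinner_scaleC_left cinner_self[of "k - G0 f"] del: of_real_power)
    then show ?thesis
      using \<open>k' - G1 f = _\<close> fM by simp
  qed
  then show "S = M z"
    using S by auto
qed

text \<open>The bound for the boundary problem makes the resolvent relation single-valued, so the
  choice inside \<open>op_app\<close> returns the boundary value of any solution.\<close>

lemma weyl_resolvent_unique:
  assumes z: "Im z * Im \<mu> > 0" and f: "f \<in> defect_hat Dom z" "G1 f + \<mu> *\<^sub>C G0 f = u"
  shows "op_app (res_rel (M z) \<mu>) u = G0 f"
proof (rule op_app_eq)
  show "(u, G0 f) \<in> res_rel (M z) \<mu>"
    using f unfolding res_rel_def weyl_rel_def by blast
  have "G0 x = G0 y" if "x \<in> defect_hat Dom z" "y \<in> defect_hat Dom z"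
    "G1 x + \<mu> *\<^sub>C G0 x = G1 y + \<mu> *\<^sub>C G0 y" for x y
  proof -
    have "min \<bar>Im z\<bar> \<bar>Im \<mu>\<bar> * cnorm (G0 (x - y)) \<le> 0"
      using boundary_problem_bound(2)[OF z, of "x - y"] csubspace_diff[OF defect_hat_csubspace that(1,2)] that
      by (simp add: defect_hat_iff G_diff scaleC_simps algebra_simps)
    moreover have "min \<bar>Im z\<bar> \<bar>Im \<mu>\<bar> > 0"
      using z by (auto simp: zero_less_mult_iff)
    ultimately have "G0 (x - y) = 0"
      by (simp add: mult_le_0_iff)
    then show ?thesis
      using that by (simp add: G_diff defect_hatD(1))
  qed
  then show "is_operator (res_rel (M z) \<mu>)"
    unfolding is_operator_def res_rel_def weyl_rel_def by auto
qed

lemma weyl_resolvent_holomorphic: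
  "(\<lambda>z. cinner (op_app (res_rel (M z) \<i>) u) v) holomorphic_on {z. Im z > 0}"
proof -
  have "\<exists>f. f \<in> defect_hat Dom z \<and> G1 f + \<i> *\<^sub>C G0 f = u" if "Im z > 0" for z
  proof -
    have "Im z * Im \<i> > 0"
      using that by simp
    then show ?thesis
      using boundary_problem_solvable[of z \<i> 0 u] by (metis defect_hat_iff)
  qed
  then obtain f where f: "\<And>z. Im z > 0 \<Longrightarrow> f z \<in> defect_hat Dom z"
      "\<And>z. Im z > 0 \<Longrightarrow> G1 (f z) + \<i> *\<^sub>C G0 (f z) = u"
    by metis
  have R: "op_app (res_rel (M z) \<i>) u = G0 (f z)" if "Im z > 0" for z
    by (rule weyl_resolvent_unique) (use f that in auto)
  have "(\<lambda>z. cinner (G0 (f z)) v) holomorphic_on {z. Im z > 0}"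
  proof (rule holomorphic_on_open[OF open_halfspace_Im_gt, THEN iffD2], clarify)
    fix w :: complex
    assume w: "Im w > 0"
    \<comment> \<open>The solution of the adjoint problem at the fixed point w. It represents v as
      G1 g - \<i> G0 g, so that the pairing with v can be evaluated by the Green identity.\<close>
    obtain g where g: "g \<in> Dom" "snd g - cnj w *\<^sub>C fst g = 0" "G1 g + (- \<i>) *\<^sub>C G0 g = v"
      by (rule boundary_problem_solvable[of "cnj w" "- \<i>" 0 v]) (use w in auto)
    have g': "g \<in> defect_hat Dom (cnj w)"
      using g by (simp add: defect_hat_iff)
    \<comment> \<open>Only the last term depends on z, and it vanishes at z = w. The difference
      quotient at w is therefore -(f(z), g), and differentiability reduces to continuity of this
      inner product.\<close>
    have pairing: "cinner (G0 (f z)) v = cinner u (G0 g) - (z - w) * cinner (fst (f z)) (fst g)"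
      if z: "Im z > 0" for z
    proof -
      have v': "G1 g = v + \<i> *\<^sub>C G0 g" and u': "G1 (f z) = u - \<i> *\<^sub>C G0 (f z)"
        using g(3) f(2)[OF z] by (auto simp: scaleC_minus_left algebra_simps)
      show ?thesis
        using weyl_green[OF f(1)[OF z] g'] unfolding v' u' by (simp add: cinner_simps)
    qed
    have lim: "((\<lambda>z. - cinner (fst (f z)) (fst g)) \<longlongrightarrow> - cinner (fst (f w)) (fst g)) (at w)"
    proof (intro tendsto_minus, subst LIM_zero_iff[symmetric], rule Lim_null_comparison)
      \<comment> \<open>The bound for the boundary problem applied to f(z) - f(w), which solves it
        with data (z - w) f(w) and 0. The bound b is continuous with b w = 0.\<close>
      define b where "b z = cmod (z - w) * cnorm (fst (f w)) / min \<bar>Im z\<bar> 1 * cnorm (fst g)" for z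
      have "isCont b w"
        unfolding b_def using w by (intro continuous_intros) auto
      then show "(b \<longlongrightarrow> 0) (at w)"
        by (simp add: isCont_def b_def[of w])
      have "cmod (cinner (fst (f z)) (fst g) - cinner (fst (f w)) (fst g)) \<le> b z" if z: "Im z > 0" for z
      proof -
        have d: "f z - f w \<in> Dom"
          using f(1) z w by (intro csubspace_diff Dom_csubspace) (auto intro: defect_hatD(1))
        have "snd (f z - f w) - z *\<^sub>C fst (f z - f w) = (z - w) *\<^sub>C fst (f w)"
          using defect_hatD(2)[OF f(1)[OF z]] defect_hatD(2)[OF f(1)[OF w]] by (simp add: scaleC_simps)
        moreover have "G1 (f z - f w) + \<i> *\<^sub>C G0 (f z - f w) = 0"
          using f(2)[OF z] f(2)[OF w] f(1)[OF z] f(1)[OF w]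
          by (simp add: G_diff defect_hatD scaleC_simps algebra_simps)
        ultimately have "min \<bar>Im z\<bar> 1 * cnorm (fst (f z - f w)) \<le> cmod (z - w) * cnorm (fst (f w))"
          using boundary_problem_bound(1)[OF _ d, of z \<i>] z by (simp add: cnorm_scaleC)
        moreover have "min \<bar>Im z\<bar> 1 > 0"
          using z by simp
        ultimately have "cnorm (fst (f z - f w)) \<le> cmod (z - w) * cnorm (fst (f w)) / min \<bar>Im z\<bar> 1"
          by (simp add: pos_le_divide_eq mult.commute)
        then have "cnorm (fst (f z - f w)) * cnorm (fst g) \<le> b z"
          unfolding b_def by (rule mult_right_mono) simp
        then show ?thesis
          using Cauchy_Schwarz_cinner[of "fst (f z - f w)" "fst g"] by (simp add: cinner_simps)
      qed
      moreover have "\<forall>\<^sub>F z in at w. Im z > 0"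
        using w by (intro eventually_at_in_open'[of "{z. Im z > 0}", simplified] open_halfspace_Im_gt) auto
      ultimately show "\<forall>\<^sub>F z in at w. cmod (cinner (fst (f z)) (fst g) - cinner (fst (f w)) (fst g)) \<le> b z"
        by (auto elim: eventually_mono)
    qed
    have "((\<lambda>z. (cinner (G0 (f z)) v - cinner (G0 (f w)) v) / (z - w)) \<longlongrightarrow> - cinner (fst (f w)) (fst g)) (at w)"
    proof (rule Lim_transform_within_open[OF lim open_halfspace_Im_gt[of 0]])
      show "w \<in> {z. Im z > 0}"
        using w by simp
      show "- cinner (fst (f z)) (fst g) = (cinner (G0 (f z)) v - cinner (G0 (f w)) v) / (z - w)"
        if "z \<in> {z. Im z > 0}" "z \<noteq> w" for z
        using pairing[of z] pairing[of w] w that by simp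
    qed
    then show "\<exists>D. ((\<lambda>z. cinner (G0 (f z)) v) has_field_derivative D) (at w)"
      unfolding has_field_derivative_iff by blast
  qed
  then show ?thesis
    by (rule holomorphic_transform) (simp add: R)
qed

lemma weyl_nevanlinna_Rs: "nevanlinna_Rs M"
  unfolding nevanlinna_Rs_def nevanlinna_R_def
proof (intro conjI allI impI exI[of _ \<i>])
  fix z :: complex
  assume "Im z > 0"
  have "\<exists>h. (u, h) \<in> res_rel (M z) \<i>" for u
  proof -
    obtain f where "f \<in> Dom" "snd f - z *\<^sub>C fst f = 0" "G1 f + \<i> *\<^sub>C G0 f = u"
      by (rule boundary_problem_solvable[of z \<i> 0 u]) (use \<open>Im z > 0\<close> in auto)
    then show ?thesis
      unfolding res_rel_def weyl_rel_def defect_hat_iff by blast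
  qed
  then show "Domain (res_rel (M z) \<i>) = UNIV"
    by blast
next
  fix h h'
  assume h: "(h, h') \<in> M \<i> \<and> Im (cinner h' h) = 0"
  then obtain f where f: "f \<in> defect_hat Dom \<i>" "h = G0 f" "h' = G1 f"
    unfolding weyl_rel_def by blast
  then have "fst f = 0"
    using weyl_Im[OF f(1)] h by simp
  then have "f = 0"
    using defect_hatD(2)[OF f(1)] by (simp add: prod_eq_iff)
  then show "h = 0"
    by (simp add: f G_zero)
qed (use weyl_csubspace weyl_is_operator weyl_hclosed weyl_max_dissipative weyl_adjoint
    weyl_resolvent_holomorphic in auto)

section \<open>Closability of the \<gamma>-field and essential selfadjointness of A0\<close>

lemma hclosure_gammaE:
  assumes "(h, g) \<in> hclosure (\<gamma> z)"
  obtains F where "\<And>n. F n \<in> defect_hat Dom z" "cconv (\<lambda>n. G0 (F n)) h" "cconv (\<lambda>n. fst (F n)) g"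
proof -
  obtain P where P: "\<And>n. P n \<in> \<gamma> z" "cconv P (h, g)"
    using assms hclosureE by blast
  have "\<exists>f. f \<in> defect_hat Dom z \<and> P n = (G0 f, fst f)" for n
    using P(1)[of n] unfolding gamma_rel_def by blast
  then obtain F where F: "\<And>n. F n \<in> defect_hat Dom z" "\<And>n. P n = (G0 (F n), fst (F n))"
    by metis
  then show ?thesis
    using that[OF F(1)] cconv_fst[OF P(2)] cconv_snd[OF P(2)] by simp
qed

text \<open>Solve e' - cnj z e = x with e in \<open>Dom\<close>. If (x, y) is in the adjoint of
  \<open>\<gamma> z\<close>, the Green identity puts (G0 e, G1 e - y) into M(z)* = M(cnj z). Hence
  some defect element g at cnj z has G0 g = G0 e, and e - g lies in \<open>A0\<close> with the same
  right-hand side x.\<close>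

lemma Domain_radjoint_gamma:
  assumes z: "Im z \<noteq> 0" and x: "x \<in> Domain (radjoint (\<gamma> z))"
  shows "\<exists>a a'. (a, a') \<in> A0 \<and> a' - cnj z *\<^sub>C a = x"
proof -
  obtain y where y: "(x, y) \<in> radjoint (\<gamma> z)"
    using x by blast
  obtain \<mu> where "Im (cnj z) * Im \<mu> > 0"
    using ex_same_sign[of "cnj z"] z by auto
  then obtain e where e: "e \<in> Dom" "snd e - cnj z *\<^sub>C fst e = x"
    using boundary_problem_solvable[of "cnj z" \<mu> x 0] by blast
  have "(G0 e, G1 e - y) \<in> M (cnj z)"
    unfolding weyl_adjoint[OF z, symmetric] radjoint_iff
  proof (intro allI impI)
    fix u u'
    assume "(u, u') \<in> M z"
    then obtain f where f: "f \<in> defect_hat Dom z" "u = G0 f" "u' = G1 f"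
      unfolding weyl_rel_def by blast
    have "cinner (fst f) x = cinner (G0 f) y"
      using y gammaI[OF f(1)] unfolding radjoint_iff by blast
    then show "cinner u' (G0 e) = cinner u (G1 e - y)"
      using green[OF defect_hatD(1)[OF f(1)] e(1)] defect_hatD(2)[OF f(1)]
      by (simp add: f e(2)[symmetric] cinner_simps algebra_simps)
  qed
  then obtain g where g: "g \<in> defect_hat Dom (cnj z)" "G0 e = G0 g"
    unfolding weyl_rel_def by blast
  have "e - g \<in> A0"
    using e(1) g by (simp add: A0_rel_def G_diff defect_hatD csubspace_diff Dom_csubspace)
  moreover have "snd (e - g) - cnj z *\<^sub>C fst (e - g) = x"
    using e(2) defect_hatD(2)[OF g(1)] by (simp add: scaleC_simps)
  ultimately show ?thesis
    by (metis prod.collapse)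
qed

text \<open>v is orthogonal to ran (A0 - cnj z), which contains the domain of the adjoint of
  \<open>\<gamma> z\<close>. That domain is dense because \<open>\<gamma> z\<close> is
  closable.\<close>

lemma gamma_closable_imp:
  assumes z: "Im z \<noteq> 0" and cl: "rclosable (\<gamma> z)" and v: "(v, z *\<^sub>C v) \<in> radjoint A0"
  shows "v = 0"
proof (rule closable_imp_radjoint_Domain_dense[OF gamma_csubspace cl])
  fix y
  assume "y \<in> Domain (radjoint (\<gamma> z))"
  then show "cinner y v = 0"
    using Domain_radjoint_gamma[OF z] orth_range_iff_radjoint[of A0 "cnj z" v] v by auto
qed

lemma ess_selfadjoint_imp_gamma_closable:
  assumes ess: "ess_selfadjoint A0" and z: "Im z \<noteq> 0"
  shows "rclosable (\<gamma> z)"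
  unfolding rclosable_iff[OF gamma_csubspace]
proof (intro allI impI)
  fix g
  assume g: "(0, g) \<in> hclosure (\<gamma> z)"
  obtain F where F: "\<And>n. F n \<in> defect_hat Dom z"
    and lim: "cconv (\<lambda>n. G0 (F n)) 0" "cconv (\<lambda>n. fst (F n)) g"
    using hclosure_gammaE[OF g] by blast
  have "(g, z *\<^sub>C g) \<in> radjoint A0"
    unfolding radjoint_iff
  proof (intro allI impI)
    fix a a'
    assume a: "(a, a') \<in> A0"
    \<comment> \<open>Since G0 vanishes on \<open>A0\<close>, the uncontrolled values G1 (F n) drop
      out. What remains pairs a fixed vector with G0 (F n), which tends to 0.\<close>
    have "cinner a' (fst (F n)) - cinner a (z *\<^sub>C fst (F n)) = cinner (G1 (a, a')) (G0 (F n))" for n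
      using green[of "(a, a')" "F n"] a F[of n] by (simp add: A0_rel_def defect_hatD)
    moreover have "(\<lambda>n. cinner a' (fst (F n)) - cinner a (z *\<^sub>C fst (F n)))
        \<longlonglongrightarrow> cinner a' g - cinner a (z *\<^sub>C g)"
      by (intro tendsto_diff tendsto_cinner_right cconv_scaleC lim)
    moreover have "(\<lambda>n. cinner (G1 (a, a')) (G0 (F n))) \<longlonglongrightarrow> 0"
      using tendsto_cinner_right[OF lim(1), of "G1 (a, a')"] by simp
    ultimately show "cinner a' g = cinner a (z *\<^sub>C g)"
      using LIMSEQ_unique by fastforce
  qed
  then show "g = 0"
    using ess_selfadjoint_iff_dense_ranges[OF A0_csubspace A0_symmetric z] ess by blast
qed

lemma ess_selfadjoint_iff_gamma_closable:
  assumes "Im z \<noteq> 0"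
  shows "ess_selfadjoint A0 \<longleftrightarrow> rclosable (\<gamma> z) \<and> rclosable (\<gamma> (cnj z))"
proof (intro iffI conjI)
  assume "ess_selfadjoint A0"
  then show "rclosable (\<gamma> z)" "rclosable (\<gamma> (cnj z))"
    using assms by (simp_all add: ess_selfadjoint_imp_gamma_closable)
next
  have "Im (cnj z) \<noteq> 0"
    using assms by simp
  moreover assume "rclosable (\<gamma> z) \<and> rclosable (\<gamma> (cnj z))"
  ultimately show "ess_selfadjoint A0"
    unfolding ess_selfadjoint_iff_dense_ranges[OF A0_csubspace A0_symmetric assms]
    by (metis assms gamma_closable_imp)
qed

section \<open>The domain of the closed \<gamma>-field\<close>

lemma Domain_hclosure_gamma:
  assumes ess: "ess_selfadjoint A0" and z: "Im z \<noteq> 0"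
  shows "Domain (hclosure (\<gamma> z)) = Range (hclosure (Gamma0_graph Dom G0))"
proof (intro antisym subsetI)
  fix h
  assume "h \<in> Domain (hclosure (\<gamma> z))"
  then obtain g where g: "(h, g) \<in> hclosure (\<gamma> z)"
    by blast
  obtain F where F: "\<And>n. F n \<in> defect_hat Dom z"
    and lim: "cconv (\<lambda>n. G0 (F n)) h" "cconv (\<lambda>n. fst (F n)) g"
    using hclosure_gammaE[OF g] by blast
  \<comment> \<open>On defect elements the second component is z times the first, so convergence of
    the first components already gives convergence of F.\<close>
  have "F n = (fst (F n), z *\<^sub>C fst (F n))" for n
    using defect_hatD(2)[OF F] by (metis prod.collapse)
  then have "cconv F (g, z *\<^sub>C g)"
    using cconv_Pair[OF lim(2) cconv_scaleC[OF lim(2), of z]] by simp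
  moreover have "(F n, G0 (F n)) \<in> Gamma0_graph Dom G0" for n
    using defect_hatD(1)[OF F] unfolding Gamma0_graph_def by blast
  ultimately have "((g, z *\<^sub>C g), h) \<in> hclosure (Gamma0_graph Dom G0)"
    using lim(1) by (intro hclosureI[where X = "\<lambda>n. (F n, G0 (F n))"] cconv_Pair)
  then show "h \<in> Range (hclosure (Gamma0_graph Dom G0))"
    by blast
next
  fix h
  assume "h \<in> Range (hclosure (Gamma0_graph Dom G0))"
  then obtain f P where P: "\<And>n. P n \<in> Gamma0_graph Dom G0" "cconv P (f, h)"
    using hclosureE by blast
  have "\<exists>f. f \<in> Dom \<and> P n = (f, G0 f)" for n
    using P(1)[of n] unfolding Gamma0_graph_def by blast
  then obtain F where F: "\<And>n. F n \<in> Dom" "\<And>n. P n = (F n, G0 (F n))"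
    by metis
  have lim: "cconv F f" "cconv (\<lambda>n. G0 (F n)) h"
    using cconv_fst[OF P(2)] cconv_snd[OF P(2)] by (simp_all add: F(2))
  \<comment> \<open>Essential selfadjointness makes closure(A0) - z surjective. The resulting x has
    the same image as f, so f - x satisfies the defect equation, although it need not lie in
    \<open>Dom\<close>.\<close>
  have "\<exists>x x'. (x, x') \<in> hclosure A0 \<and> x' - z *\<^sub>C x = snd f - z *\<^sub>C fst f"
  proof (rule symmetric_hclosure_range[OF A0_csubspace A0_symmetric z])
    show "v = 0" if "\<And>x x'. (x, x') \<in> A0 \<Longrightarrow> cinner (x' - z *\<^sub>C x) v = 0" for v
      using that orth_range_iff_radjoint[of A0 z v]
        ess_selfadjoint_iff_dense_ranges[OF A0_csubspace A0_symmetric z] ess by blast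
  qed
  then obtain x where "x \<in> hclosure A0" and x: "snd x - z *\<^sub>C fst x = snd f - z *\<^sub>C fst f"
    by auto
  then obtain A where A: "\<And>n. A n \<in> A0" "cconv A x"
    using hclosureE by blast
  \<comment> \<open>Subtracting the approximants of x in \<open>A0\<close> keeps G0 unchanged. The
    corrected sequence converges to f - x, so its residual w in the defect equation tends to
    0.\<close>
  define D where "D n = F n - A n" for n
  have D: "D n \<in> Dom" "G0 (D n) = G0 (F n)" for n
    using A(1)[of n] F(1)[of n]
    by (simp_all add: D_def A0_rel_def G_diff csubspace_diff Dom_csubspace)
  define w where "w n = snd (D n) - z *\<^sub>C fst (D n)" for n
  have D_lim: "cconv D (f - x)"
    unfolding D_def by (intro cconv_diff lim A)
  have "cconv w (snd (f - x) - z *\<^sub>C fst (f - x))"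
    unfolding w_def by (intro cconv_diff cconv_scaleC cconv_fst cconv_snd D_lim)
  moreover have Dx: "snd (f - x) - z *\<^sub>C fst (f - x) = 0"
    using x by (simp add: scaleC_simps algebra_simps)
  ultimately have w_lim: "(\<lambda>n. cnorm (w n)) \<longlonglongrightarrow> 0"
    unfolding Dx by (simp add: cconv_def)
  obtain \<mu> where \<mu>: "Im z * Im \<mu> > 0"
    using ex_same_sign[OF z] by blast
  define c where "c = min \<bar>Im z\<bar> \<bar>Im \<mu>\<bar>"
  have c: "c > 0"
    using \<mu> by (auto simp: c_def zero_less_mult_iff)
  \<comment> \<open>E n removes the residual exactly, so D n - E n is a defect element. The boundary
    condition with zero data bounds both E n and G0 (E n) by |w n|/c, and the limits are
    unaffected.\<close>
  have "\<exists>e. e \<in> Dom \<and> snd e - z *\<^sub>C fst e = w n \<and> G1 e + \<mu> *\<^sub>C G0 e = 0" for n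
    using boundary_problem_solvable[OF \<mu>, of "w n" 0] by metis
  then obtain E where E: "\<And>n. E n \<in> Dom" "\<And>n. snd (E n) - z *\<^sub>C fst (E n) = w n"
    "\<And>n. G1 (E n) + \<mu> *\<^sub>C G0 (E n) = 0"
    by metis
  have w_lim': "(\<lambda>n. cnorm (w n) / c) \<longlonglongrightarrow> 0"
    using tendsto_divide[OF w_lim tendsto_const[of c]] c by simp
  have "cnorm (fst (E n)) \<le> cnorm (w n) / c" "cnorm (G0 (E n)) \<le> cnorm (w n) / c" for n
    using boundary_problem_bound[OF \<mu> E(1), of n] c
    unfolding E(2,3) c_def[symmetric] by (simp_all add: pos_le_divide_eq mult.commute)
  then have E_lim: "cconv (\<lambda>n. fst (E n)) 0" "cconv (\<lambda>n. G0 (E n)) 0"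
    by (auto intro!: cconv_comparison[OF w_lim'])
  have "D n - E n \<in> defect_hat Dom z" for n
    using D(1)[of n] E(1,2)[of n]
    by (simp add: defect_hat_iff csubspace_diff Dom_csubspace w_def scaleC_simps algebra_simps)
  then have "(G0 (D n - E n), fst (D n - E n)) \<in> \<gamma> z" for n
    by (rule gammaI)
  moreover have "cconv (\<lambda>n. G0 (D n - E n)) (h - 0)"
    using cconv_diff[OF lim(2) E_lim(2)] D E(1) by (simp add: G_diff)
  moreover have "cconv (\<lambda>n. fst (D n - E n)) (fst (f - x) - 0)"
    using cconv_diff[OF cconv_fst[OF D_lim] E_lim(1)] by simp
  ultimately have "(h - 0, fst (f - x) - 0) \<in> hclosure (\<gamma> z)"
    by (intro hclosureI[where X = "\<lambda>n. (G0 (D n - E n), fst (D n - E n))"] cconv_Pair)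
  then show "h \<in> Domain (hclosure (\<gamma> z))"
    by auto
qed

end

section \<open>Assembly of the equivalences\<close>

theorem mainTheorem1:
  fixes A :: "('h::complex_hilbert \<times> 'h) set"
    and Dom :: "('h \<times> 'h) set"
    and G0 G1 :: "'h \<times> 'h \<Rightarrow> 'k::complex_hilbert"
  defines "M \<equiv> weyl_rel Dom G0 G1"
    and "\<gamma> \<equiv> gamma_rel Dom G0"
  assumes ubt: "unitary_boundary_triple A Dom G0 G1"
  shows
    "(ess_selfadjoint (A0_rel Dom G0) \<longleftrightarrow> rclosable (\<gamma> \<i>) \<and> rclosable (\<gamma> (- \<i>))) \<and>
     (ess_selfadjoint (A0_rel Dom G0) \<longleftrightarrow>
        (\<forall>z. Im z \<noteq> 0 \<longrightarrow> rclosable (\<gamma> z)) \<and>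
        (\<forall>z. Im z > 0 \<longrightarrow> Domain (hclosure (\<gamma> z)) = Domain (hclosure (\<gamma> \<i>))) \<and>
        (\<forall>z. Im z < 0 \<longrightarrow> Domain (hclosure (\<gamma> z)) = Domain (hclosure (\<gamma> (- \<i>))))) \<and>
     (ess_selfadjoint (A0_rel Dom G0) \<longleftrightarrow>
        form_closable (form_of (M \<i>) \<i>) \<and> form_closable (form_of (M (- \<i>)) (- \<i>))) \<and>
     (ess_selfadjoint (A0_rel Dom G0) \<longleftrightarrow>
        (\<forall>z. Im z \<noteq> 0 \<longrightarrow> form_closable (form_of (M z) z)) \<and>
        (\<forall>z. Im z > 0 \<longrightarrow>
           form_closure_dom (form_of (M z) z) = form_closure_dom (form_of (M \<i>) \<i>)) \<and>
        (\<forall>z. Im z < 0 \<longrightarrow>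
           form_closure_dom (form_of (M z) z) = form_closure_dom (form_of (M (- \<i>)) (- \<i>)))) \<and>
     (ess_selfadjoint (A0_rel Dom G0) \<longleftrightarrow>
        nevanlinna_Rs M \<and>
        form_domain_invariant M {z. Im z > 0} \<and> form_domain_invariant M {z. Im z < 0}) \<and>
     (ess_selfadjoint (A0_rel Dom G0) \<longrightarrow>
        (\<forall>z. Im z \<noteq> 0 \<longrightarrow>
           form_closure_dom (form_of (M z) z) = Domain (hclosure (\<gamma> z)) \<and>
           Domain (hclosure (\<gamma> z)) = Range (hclosure (Gamma0_graph Dom G0))))"
proof -
  interpret unitary_triple Dom G0 G1
    using ubt by unfold_locales (simp add: unitary_boundary_triple_def)
  let ?ess = "ess_selfadjoint (A0_rel Dom G0)"
  have ii: "?ess \<longleftrightarrow> rclosable (\<gamma> \<i>) \<and> rclosable (\<gamma> (- \<i>))"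
    using ess_selfadjoint_iff_gamma_closable[of \<i>] by (simp add: \<gamma>_def)
  have closable: "rclosable (\<gamma> z)" if ?ess "Im z \<noteq> 0" for z
    using ess_selfadjoint_imp_gamma_closable[OF that] by (simp add: \<gamma>_def)
  have dom: "Domain (hclosure (\<gamma> z)) = Range (hclosure (Gamma0_graph Dom G0))"
    if ?ess "Im z \<noteq> 0" for z
    using Domain_hclosure_gamma[OF that] by (simp add: \<gamma>_def)
  have form: "form_closable (form_of (M z) z) \<longleftrightarrow> rclosable (\<gamma> z)"
    "form_closure_dom (form_of (M z) z) = Domain (hclosure (\<gamma> z))" if "Im z \<noteq> 0" for z
    using form_closable_weyl_iff[OF that] form_closure_dom_weyl[OF that]
    by (simp_all add: \<gamma>_def M_def)
  have R: "nevanlinna_Rs M"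
    using weyl_nevanlinna_Rs by (simp add: M_def)
  have iii: "?ess \<longleftrightarrow>
      (\<forall>z. Im z \<noteq> 0 \<longrightarrow> rclosable (\<gamma> z)) \<and>
      (\<forall>z. Im z > 0 \<longrightarrow> Domain (hclosure (\<gamma> z)) = Domain (hclosure (\<gamma> \<i>))) \<and>
      (\<forall>z. Im z < 0 \<longrightarrow> Domain (hclosure (\<gamma> z)) = Domain (hclosure (\<gamma> (- \<i>))))"
    (is "_ \<longleftrightarrow> ?iii")
  proof
    \<comment> \<open>All the closed domains equal ran closure(Gamma_0), which does not depend on
      z.\<close>
    show ?iii if ?ess
      using closable[OF that] by (simp add: dom[OF that])
    show ?ess if ?iii
      using that by (simp add: ii)
  qed
  have iv: "?ess \<longleftrightarrow> form_closable (form_of (M \<i>) \<i>) \<and> form_closable (form_of (M (- \<i>)) (- \<i>))"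
    using ii by (simp add: form)
  have v: "?ess \<longleftrightarrow>
      (\<forall>z. Im z \<noteq> 0 \<longrightarrow> form_closable (form_of (M z) z)) \<and>
      (\<forall>z. Im z > 0 \<longrightarrow>
         form_closure_dom (form_of (M z) z) = form_closure_dom (form_of (M \<i>) \<i>)) \<and>
      (\<forall>z. Im z < 0 \<longrightarrow>
         form_closure_dom (form_of (M z) z) = form_closure_dom (form_of (M (- \<i>)) (- \<i>)))"
    unfolding iii by (simp add: form)
  have "form_domain_invariant M {z. Im z > 0} \<and> form_domain_invariant M {z. Im z < 0}" if ?ess
    unfolding form_domain_invariant_def by (simp add: form closable[OF that] dom[OF that])
  \<comment> \<open>The points \<i> and -\<i> lie in the two half-planes, so invariance of the form
    domains contains (iv).\<close>
  moreover have "?ess" if "form_domain_invariant M {z. Im z > 0}" "form_domain_invariant M {z. Im z < 0}"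
    using that unfolding iv form_domain_invariant_def by simp
  ultimately have vi: "?ess \<longleftrightarrow> nevanlinna_Rs M \<and>
      form_domain_invariant M {z. Im z > 0} \<and> form_domain_invariant M {z. Im z < 0}"
    using R by blast
  have dom_eq: "?ess \<longrightarrow> (\<forall>z. Im z \<noteq> 0 \<longrightarrow>
      form_closure_dom (form_of (M z) z) = Domain (hclosure (\<gamma> z)) \<and>
      Domain (hclosure (\<gamma> z)) = Range (hclosure (Gamma0_graph Dom G0)))"
    using form(2) dom by metis
  show ?thesis
    by (intro conjI ii iii iv v vi dom_eq)
qed

end
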